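(* Let $\mathcal{A}$ be an associative unital algebra over $\mathbb{C}$. The conditionally monotone additive convolution, defined on pairs $(\Phi_1,\Psi_1)$, $(\Phi_2,\Psi_2)$ of characters on the double tensor Hopf algebra $T(T_+(\mathcal{A}))$ by $$(\Phi_1,\Psi_1)*(\Phi_2,\Psi_2):=\Big(\mathcal{E}_\succ\big(\beta_2+\Psi_2^{*-1}\succ\beta_1\prec\Psi_2\big),\ \Psi_1*\Psi_2\Big),$$ where $\beta_1,\beta_2$ are the infinitesimal characters with $\Phi_1=\mathcal{E}_\succ(\beta_1)$ and $\Phi_2=\mathcal{E}_\succ(\beta_2)$, is an associative product on the set of pairs of characters of $T(T_+(\mathcal{A}))$.
   Context: **Double tensor Hopf algebra.** $T_+(\mathcal{A})=\bigoplus_{n\ge1}\mathcal{A}^{\otimes n}$ and $T(T_+(\mathcal{A}))=\bigoplus_{n\ge0}T_+(\mathcal{A})^{\otimes n}$. A word $a_1\cdots a_n$ in $T_+(\mathcal{A})$ denotes $a_1\otimes\cdots\otimes a_n$; pure tensors in $T(T_+(\mathcal{A}))$ are written $w_1|\cdots|w_m$. The product is concatenation with $|$, with unit the empty word $\mathbf{1}$. For $w=a_1\cdots a_n$ and $S=\{s_1<\dots<s_l\}\subseteq[n]=\{1,\dots,n\}$ let $w_S=a_{s_1}\cdots a_{s_l}$ ($w_\emptyset=\mathbf{1}$), and let $J_1,\dots,J_r$ be the connected components (maximal intervals of consecutive integers) of $[n]\setminus S$, ordered by minimal elements. The coproduct is $\Delta(w)=\sum_{S\subseteq[n]}w_S\otimes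 w_{J_1}|\cdots|w_{J_r}$, extended multiplicatively; the counit $\epsilon$ is the unital algebra morphism vanishing on $T_+(\mathcal{A})$. Split $\Delta=\Delta_\prec+\Delta_\succ$ on the augmentation ideal, where $\Delta_\prec(w)=\sum_{1\in S\subseteq[n]}w_S\otimes w_{J_1}|\cdots|w_{J_r}$ on words and $\Delta_\prec(w_1|w_2|\cdots|w_m)=\Delta_\prec(w_1)\Delta(w_2|\cdots|w_m)$, and likewise for $\Delta_\succ$. **Products on the dual.** For linear forms $f,g$ on $T(T_+(\mathcal{A}))$: $f*g=m_{\mathbb{C}}(f\otimes g)\Delta$ (associative, unit $\epsilon$), $f\prec g=m_{\mathbb{C}}(f\otimes g)\Delta_\prec$, $f\succ g=m_{\mathbb{C}}(f\otimes g)\Delta_\succ$, with $f\prec\epsilon=f=\epsilon\succ f$ and $\epsilon\prec f=0=f\succ\epsilon$ for $f\ne\epsilon$; half-shuffle products are only used when at least one factor vanishes on $\mathbf{1}$, and then they vanish on $\mathbf{1}$. They satisfy $(f\prec g)\prec h=f\prec(g*h)$, $(f\succ g)\prec h=f\succ(g\prec h)$, $f\succ(g\succ h)=(f*g)\succ h$. **Characters.** $G$ is the group (for $*$, with inverse $\Psi^{*-1}$) of characters, i.e. unital algebra morphisms $T(T_+(\mathcal{A}))\to\mathbb{C}$. $\mathfrak{g}$ is the space of infinitesimal characters: linear forms $\alpha$ with $\alpha(\mathbf{1})=0$ and $\alpha(w_1|\cdots|w_k)=0$ for all $k\ge2$, $w_i\in T_+(\mathcal{A})$. The map $\mathcal{E}_\succ(\alpha)=\sum_{n\ge0}\alpha^{\succ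 n}$ ($\alpha^{\succ0}=\epsilon$, $\alpha^{\succ n}=\alpha^{\succ(n-1)}\succ\alpha$) is a bijection $\mathfrak{g}\to G$. For $\Psi\in G$ and $\alpha\in\mathfrak{g}$, $\Psi^{*-1}\succ\alpha\prec\Psi$ is an infinitesimal character. *)

theory Defs
  imports Complex_Main "HOL-Library.Poly_Mapping"
begin

section \<open>Complex vector spaces and unital algebras\<close>

class complex_vector = ab_group_add +
  fixes scaleC :: "complex \<Rightarrow> 'a \<Rightarrow> 'a" (infixr "*\<^sub>C" 75)
  assumes scaleC_add_right: "c *\<^sub>C (x + y) = c *\<^sub>C x + c *\<^sub>C y"
    and scaleC_add_left: "(c + d) *\<^sub>C x = c *\<^sub>C x + d *\<^sub>C x"
    and scaleC_scaleC: "c *\<^sub>C d *\<^sub>C x = (c * d) *\<^sub>C x"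
    and scaleC_one: "1 *\<^sub>C x = x"

text \<open>The zero algebra is allowed: \<open>0 \<noteq> 1\<close> is not required.\<close>

class complex_algebra_1 = complex_vector + ring + monoid_mult +
  assumes mult_scaleC_left: "(c *\<^sub>C x) * y = c *\<^sub>C (x * y)"
    and mult_scaleC_right: "x * (c *\<^sub>C y) = c *\<^sub>C (x * y)"

global_interpretation cvec: vector_space "scaleC :: complex \<Rightarrow> 'a \<Rightarrow> 'a::complex_vector"
  by unfold_locales
    (simp_all add: scaleC_add_right scaleC_add_left scaleC_scaleC scaleC_one)

abbreviation clinear :: "('a::complex_vector \<Rightarrow> 'b::complex_vector) \<Rightarrow> bool"
  where "clinear \<equiv> Vector_Spaces.linear scaleC scaleC"

lemma clinear_iff:
  "clinear f \<longleftrightarrow> (\<forall>x y. f (x + y) = f x + f y) \<and> (\<forall>c x. f (c *\<^sub>C x) = c *\<^sub>C f x)"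
  by (auto simp: Vector_Spaces.linear_iff cvec.vector_space_axioms)

lemma clinear_add: "clinear f \<Longrightarrow> f (x + y) = f x + f y"
  and clinear_scale: "clinear f \<Longrightarrow> f (c *\<^sub>C x) = c *\<^sub>C f x"
  by (auto simp: clinear_iff)

lemma clinear_zero: "clinear f \<Longrightarrow> f 0 = 0"
  by (metis clinear_scale cvec.scale_zero_left)

lemma clinear_diff: "clinear f \<Longrightarrow> f (x - y) = f x - f y"
  by (metis add_diff_cancel clinear_add diff_add_cancel)

lemma clinear_sum: "clinear f \<Longrightarrow> f (sum g S) = (\<Sum>i\<in>S. f (g i))"
  by (induction S rule: infinite_finite_induct) (auto simp: clinear_zero clinear_add)

lemma clinear_scale_fun: "clinear f \<Longrightarrow> clinear (\<lambda>x. c *\<^sub>C f x)"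
  by (auto simp: clinear_iff cvec.scale_right_distrib mult.commute)

lemma clinear_add_fun: "clinear f \<Longrightarrow> clinear g \<Longrightarrow> clinear (\<lambda>x. f x + g x)"
  by (auto simp: clinear_iff cvec.scale_right_distrib)

lemma clinear_zero_fun: "clinear (\<lambda>x. 0)"
  by (auto simp: clinear_iff)

lemma clinear_sum_fun: "(\<And>i. i \<in> S \<Longrightarrow> clinear (f i)) \<Longrightarrow> clinear (\<lambda>x. \<Sum>i\<in>S. f i x)"
  by (induction S rule: infinite_finite_induct) (auto simp: clinear_zero_fun clinear_add_fun)

lemma clinear_compose: "clinear f \<Longrightarrow> clinear g \<Longrightarrow> clinear (\<lambda>x. g (f x))"
  by (auto simp: clinear_iff)

instantiation complex :: complex_algebra_1
begin
definition scaleC_complex :: "complex \<Rightarrow> complex \<Rightarrow> complex" where "scaleC_complex = (*)"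
instance by standard (auto simp: scaleC_complex_def algebra_simps)
end

section \<open>Free vector spaces\<close>

instantiation poly_mapping :: (type, complex_vector) complex_vector
begin

definition scaleC_poly_mapping ::
  "complex \<Rightarrow> ('a, 'b) poly_mapping \<Rightarrow> ('a, 'b) poly_mapping"
  where "scaleC_poly_mapping c p = Poly_Mapping.map (scaleC c) p"

lemma lookup_scaleC:
  "Poly_Mapping.lookup (c *\<^sub>C p) k = c *\<^sub>C Poly_Mapping.lookup (p :: ('a, 'b) poly_mapping) k"
  by (simp add: scaleC_poly_mapping_def map.rep_eq when_def)

instance
  by standard
    (auto intro!: poly_mapping_eqI
      simp: lookup_scaleC lookup_add scaleC_add_right scaleC_add_left scaleC_scaleC scaleC_one)
end

lemma single_scaleC: "Poly_Mapping.single k (c *\<^sub>C d) = c *\<^sub>C Poly_Mapping.single k d"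
  by (auto intro!: poly_mapping_eqI simp: lookup_scaleC lookup_single when_def)

abbreviation gen :: "'b \<Rightarrow> 'b \<Rightarrow>\<^sub>0 complex" where "gen b \<equiv> Poly_Mapping.single b 1"

definition free_lift :: "('b \<Rightarrow> 'v::complex_vector) \<Rightarrow> ('b \<Rightarrow>\<^sub>0 complex) \<Rightarrow> 'v"
  where "free_lift h p = (\<Sum>b\<in>Poly_Mapping.keys p. Poly_Mapping.lookup p b *\<^sub>C h b)"

lemma free_lift_superset:
  assumes "finite S" "Poly_Mapping.keys p \<subseteq> S"
  shows "free_lift h p = (\<Sum>b\<in>S. Poly_Mapping.lookup p b *\<^sub>C h b)"
  unfolding free_lift_def using assms
  by (intro sum.mono_neutral_left) (auto simp: in_keys_iff)

lemma clinear_free_lift: "clinear (free_lift h)"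
proof -
  have add: "free_lift h (p + q) = free_lift h p + free_lift h q" for p q
  proof -
    let ?S = "Poly_Mapping.keys p \<union> Poly_Mapping.keys q"
    have "Poly_Mapping.keys (p + q) \<subseteq> ?S" by (rule keys_add)
    then show ?thesis
      by (simp add: free_lift_superset[of ?S] lookup_add cvec.scale_left_distrib sum.distrib)
  qed
  have scale: "free_lift h (c *\<^sub>C p) = c *\<^sub>C free_lift h p" for c p
  proof -
    have "Poly_Mapping.keys (c *\<^sub>C p) \<subseteq> Poly_Mapping.keys p" by (auto simp: in_keys_iff lookup_scaleC)
    then show ?thesis
      by (simp add: free_lift_superset[of "Poly_Mapping.keys p"] lookup_scaleC cvec.scale_sum_right
          scaleC_complex_def)
  qed
  show ?thesis using add scale by (auto simp: clinear_iff)
qed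

lemma free_lift_gen [simp]: "free_lift h (gen b) = h b"
  by (simp add: free_lift_def scaleC_one)

lemma free_induct [case_names gen add scale]:
  assumes "\<And>b. P (gen b)" "\<And>p q. P p \<Longrightarrow> P q \<Longrightarrow> P (p + q)" "\<And>c p. P p \<Longrightarrow> P (c *\<^sub>C p)"
  shows "P (p :: 'b \<Rightarrow>\<^sub>0 complex)"
proof -
  have zero: "P 0"
    using assms(3)[of "gen undefined" 0] assms(1) by simp
  show ?thesis
  proof (induction p rule: update_induct)
    case (const)
    show ?case by (rule zero)
  next
    case (update f a b)
    have "Poly_Mapping.update a b f = f + b *\<^sub>C gen a"
      using update(1)
      by (auto intro!: poly_mapping_eqI
          simp: lookup_update lookup_add lookup_scaleC lookup_single when_def in_keys_iff scaleC_complex_def)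
    then show ?case using assms update by simp
  qed
qed

lemma free_lift_eq_if_diff_in_span:
  assumes "\<And>r. r \<in> R \<Longrightarrow> free_lift h r = 0" "p - q \<in> cvec.span R"
  shows "free_lift h p = free_lift h q"
proof -
  have "free_lift h (p - q) = 0"
    using assms(2)
  proof (induction rule: cvec.span_induct_alt)
    case base
    show ?case by (simp add: clinear_zero clinear_free_lift)
  next
    case (step c x y)
    then show ?case
      using assms(1) by (simp add: clinear_add[OF clinear_free_lift] clinear_scale[OF clinear_free_lift])
  qed
  then show ?thesis by (simp add: clinear_diff[OF clinear_free_lift])
qed

section \<open>The tensor product of two vector spaces\<close>

definition tensor_rels :: "('v::complex_vector \<times> 'w::complex_vector \<Rightarrow>\<^sub>0 complex) set"
  where "tensor_rels =
    {gen (a + a', b) - gen (a, b) - gen (a', b) | a a' b. True} \<union>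
    {gen (a, b + b') - gen (a, b) - gen (a, b') | a b b'. True} \<union>
    {gen (c *\<^sub>C a, b) - c *\<^sub>C gen (a, b) | c a b. True} \<union>
    {gen (a, c *\<^sub>C b) - c *\<^sub>C gen (a, b) | c a b. True}"

lemma equivp_span: "equivp (\<lambda>p q. p - q \<in> cvec.span R)"
proof (intro equivpI reflpI sympI transpI)
  fix x y z :: "'a"
  show "x - x \<in> cvec.span R" by (simp add: cvec.span_zero)
  show "x - y \<in> cvec.span R \<Longrightarrow> y - x \<in> cvec.span R"
    by (metis cvec.span_neg minus_diff_eq)
  show "x - y \<in> cvec.span R \<Longrightarrow> y - z \<in> cvec.span R \<Longrightarrow> x - z \<in> cvec.span R"
    using cvec.span_add[of "x - y" R "y - z"] by simp
qed

lemma span_congs: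
  "p - p' \<in> cvec.span R \<Longrightarrow> q - q' \<in> cvec.span R \<Longrightarrow> (p + q) - (p' + q') \<in> cvec.span R"
  "p - p' \<in> cvec.span R \<Longrightarrow> q - q' \<in> cvec.span R \<Longrightarrow> (p - q) - (p' - q') \<in> cvec.span R"
  "p - p' \<in> cvec.span R \<Longrightarrow> (- p) - (- p') \<in> cvec.span R"
  "p - p' \<in> cvec.span R \<Longrightarrow> c *\<^sub>C p - c *\<^sub>C p' \<in> cvec.span R"
proof -
  assume p: "p - p' \<in> cvec.span R"
  show "(- p) - (- p') \<in> cvec.span R"
    using cvec.span_neg[OF p] by simp
  show "c *\<^sub>C p - c *\<^sub>C p' \<in> cvec.span R"
    using cvec.span_scale[OF p] by (simp add: cvec.scale_right_diff_distrib)
  assume q: "q - q' \<in> cvec.span R"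
  show "(p + q) - (p' + q') \<in> cvec.span R"
    using cvec.span_add[OF p q] by (simp add: algebra_simps)
  show "(p - q) - (p' - q') \<in> cvec.span R"
    using cvec.span_diff[OF p q] by (simp add: algebra_simps)
qed

quotient_type (overloaded) ('v, 'w) tensor =
  "('v::complex_vector \<times> 'w::complex_vector) \<Rightarrow>\<^sub>0 complex"
  / "\<lambda>p q. p - q \<in> cvec.span tensor_rels"
  by (rule equivp_span)

instantiation tensor :: (complex_vector, complex_vector) complex_vector
begin
lift_definition zero_tensor :: "('a, 'b) tensor" is 0 .
lift_definition plus_tensor :: "('a, 'b) tensor \<Rightarrow> ('a, 'b) tensor \<Rightarrow> ('a, 'b) tensor"
  is "(+)" by (rule span_congs)
lift_definition minus_tensor :: "('a, 'b) tensor \<Rightarrow> ('a, 'b) tensor \<Rightarrow> ('a, 'b) tensor"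
  is "(-)" by (rule span_congs)
lift_definition uminus_tensor :: "('a, 'b) tensor \<Rightarrow> ('a, 'b) tensor"
  is uminus by (rule span_congs)
lift_definition scaleC_tensor :: "complex \<Rightarrow> ('a, 'b) tensor \<Rightarrow> ('a, 'b) tensor"
  is scaleC by (rule span_congs)
instance
  by standard (transfer; simp add: cvec.span_zero algebra_simps scaleC_add_right
      scaleC_add_left scaleC_scaleC scaleC_one)+
end

lift_definition tens :: "'v::complex_vector \<Rightarrow> 'w::complex_vector \<Rightarrow> ('v, 'w) tensor"
    (infixr "\<otimes>" 70)
  is "\<lambda>a b. gen (a, b)" .

definition cbilinear ::
  "('v::complex_vector \<Rightarrow> 'w::complex_vector \<Rightarrow> 'u::complex_vector) \<Rightarrow> bool"
  where "cbilinear h \<longleftrightarrow> (\<forall>b. clinear (\<lambda>a. h a b)) \<and> (\<forall>a. clinear (h a))"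

text \<open>The map out of the tensor product induced by \<open>h\<close>; it is meaningful (independent of
  the chosen representative) only for bilinear \<open>h\<close>.\<close>

definition tensor_lift ::
  "('v::complex_vector \<Rightarrow> 'w::complex_vector \<Rightarrow> 'u::complex_vector) \<Rightarrow> ('v, 'w) tensor \<Rightarrow> 'u"
  where "tensor_lift h x = free_lift (case_prod h) (rep_tensor x)"

lemma tensor_lift_abs:
  assumes "cbilinear h"
  shows "tensor_lift h (abs_tensor p) = free_lift (case_prod h) p"
  unfolding tensor_lift_def
proof (rule free_lift_eq_if_diff_in_span)
  show "rep_tensor (abs_tensor p) - p \<in> cvec.span tensor_rels"
    using tensor.abs_eq_iff[of "rep_tensor (abs_tensor p)" p] Quotient3_abs_rep[OF Quotient3_tensor] by blast
  fix r :: "('a \<times> 'b) \<Rightarrow>\<^sub>0 complex"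
  assume "r \<in> tensor_rels"
  then show "free_lift (case_prod h) r = 0"
    using assms unfolding tensor_rels_def cbilinear_def clinear_iff
    by (auto simp: clinear_diff[OF clinear_free_lift] clinear_scale[OF clinear_free_lift])
qed

lemma tensor_lift_tens [simp]: "cbilinear h \<Longrightarrow> tensor_lift h (a \<otimes> b) = h a b"
  by (simp add: tens.abs_eq tensor_lift_abs)

lemma clinear_tensor_lift:
  assumes "cbilinear h" shows "clinear (tensor_lift h)"
proof -
  have "tensor_lift h (x + y) = tensor_lift h x + tensor_lift h y" for x y
    by (induction x rule: tensor.abs_induct; induction y rule: tensor.abs_induct) (simp add: plus_tensor.abs_eq tensor_lift_abs[OF assms]
        clinear_add[OF clinear_free_lift])
  moreover have "tensor_lift h (c *\<^sub>C x) = c *\<^sub>C tensor_lift h x" for c x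
    by (induction x rule: tensor.abs_induct) (simp add: scaleC_tensor.abs_eq tensor_lift_abs[OF assms]
        clinear_scale[OF clinear_free_lift])
  ultimately show ?thesis by (auto simp: clinear_iff)
qed

lemma tensor_induct [case_names tens add scale]:
  assumes "\<And>a b. P (a \<otimes> b)" "\<And>x y. P x \<Longrightarrow> P y \<Longrightarrow> P (x + y)" "\<And>c x. P x \<Longrightarrow> P (c *\<^sub>C x)"
  shows "P x"
proof (induction x rule: tensor.abs_induct)
  fix p
  show "P (abs_tensor p)"
  proof (induction p rule: free_induct)
    case (gen b)
    then show ?case using assms(1) by (cases b) (simp add: tens.abs_eq)
  next
    case (add p q)
    then show ?case using assms(2) by (metis plus_tensor.abs_eq)
  next
    case (scale c p)
    then show ?case using assms(3) by (metis scaleC_tensor.abs_eq)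
  qed
qed

lemma cbilinear_tens: "cbilinear (\<otimes>)"
proof -
  have "(a + a') \<otimes> b = a \<otimes> b + a' \<otimes> b" for a a' :: 'a and b :: 'b
  proof transfer
    fix a a' :: 'a and b :: 'b
    have "gen (a + a', b) - gen (a, b) - gen (a', b) \<in> cvec.span tensor_rels"
      by (rule cvec.span_base) (unfold tensor_rels_def, blast)
    then show "gen (a + a', b) - (gen (a, b) + gen (a', b)) \<in> cvec.span tensor_rels"
      by (simp add: diff_diff_eq)
  qed
  moreover have "a \<otimes> (b + b') = a \<otimes> b + a \<otimes> b'" for a :: 'a and b b' :: 'b
  proof transfer
    fix a :: 'a and b b' :: 'b
    have "gen (a, b + b') - gen (a, b) - gen (a, b') \<in> cvec.span tensor_rels"
      by (rule cvec.span_base) (unfold tensor_rels_def, blast)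
    then show "gen (a, b + b') - (gen (a, b) + gen (a, b')) \<in> cvec.span tensor_rels"
      by (simp add: diff_diff_eq)
  qed
  moreover have "(c *\<^sub>C a) \<otimes> b = c *\<^sub>C (a \<otimes> b)" for c and a :: 'a and b :: 'b
    by transfer (rule cvec.span_base, unfold tensor_rels_def, blast)
  moreover have "a \<otimes> (c *\<^sub>C b) = c *\<^sub>C (a \<otimes> b)" for c and a :: 'a and b :: 'b
    by transfer (rule cvec.span_base, unfold tensor_rels_def, blast)
  ultimately show ?thesis by (auto simp: cbilinear_def clinear_iff)
qed

lemma clinear_times_left: "clinear (\<lambda>x. x * (y :: 'a::complex_algebra_1))"
  and clinear_times_right: "clinear (\<lambda>x. (y :: 'a::complex_algebra_1) * x)"
  by (auto simp: clinear_iff algebra_simps mult_scaleC_left mult_scaleC_right)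

text \<open>The product \<open>(a \<otimes> b)(c \<otimes> d) = ac \<otimes> bd\<close> on a tensor product of algebras.\<close>

instantiation tensor :: (complex_algebra_1, complex_algebra_1) complex_algebra_1
begin

definition one_tensor :: "('a, 'b) tensor" where "one_tensor = 1 \<otimes> 1"

definition times_tensor :: "('a, 'b) tensor \<Rightarrow> ('a, 'b) tensor \<Rightarrow> ('a, 'b) tensor"
  where "times_tensor x y =
    tensor_lift (\<lambda>a b. tensor_lift (\<lambda>c d. (a * c) \<otimes> (b * d)) y) x"

lemma cbilinear_tens_times:
  "cbilinear (\<lambda>c d. ((a::'a) * c) \<otimes> ((b::'b) * d))"
  "cbilinear (\<lambda>a b. (a * (c::'a)) \<otimes> (b * (d::'b)))"
  using cbilinear_tens[where 'a='a and 'b='b]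
  by (auto simp: cbilinear_def clinear_iff algebra_simps mult_scaleC_left mult_scaleC_right)

lemma cbilinear_times_tensor:
  "cbilinear (\<lambda>a b. tensor_lift (\<lambda>c d. ((a::'a) * c) \<otimes> ((b::'b) * d)) y)"
proof (induction y rule: tensor_induct)
  case (tens c d)
  show ?case by (simp add: cbilinear_tens_times)
next
  case (add x y)
  then show ?case
    by (simp add: clinear_add[OF clinear_tensor_lift[OF cbilinear_tens_times(1)]] cbilinear_def
        clinear_add_fun)
next
  case (scale c x)
  then show ?case
    by (simp add: clinear_scale[OF clinear_tensor_lift[OF cbilinear_tens_times(1)]] cbilinear_def
        clinear_scale_fun)
qed

lemma tens_times_tens: "(a \<otimes> b) * (c \<otimes> d) = ((a * c) \<otimes> (b * d) :: ('a, 'b) tensor)"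
  by (simp add: times_tensor_def cbilinear_times_tensor cbilinear_tens_times)

lemma tensor_times_simps:
  "(x + y) * z = x * z + y * (z :: ('a, 'b) tensor)"
  "z * (x + y) = z * x + z * (y :: ('a, 'b) tensor)"
  "(c *\<^sub>C x) * z = c *\<^sub>C (x * (z :: ('a, 'b) tensor))"
  "z * (c *\<^sub>C x) = c *\<^sub>C (z * (x :: ('a, 'b) tensor))"
proof -
  note L = clinear_tensor_lift[OF cbilinear_times_tensor]
  have add: "(x + y) * z = x * z + y * z" for x y z :: "('a, 'b) tensor"
    unfolding times_tensor_def by (rule clinear_add[OF L])
  have scale: "(c *\<^sub>C x) * z = c *\<^sub>C (x * z)" for c and x z :: "('a, 'b) tensor"
    unfolding times_tensor_def by (rule clinear_scale[OF L])
  show "(x + y) * z = x * z + y * z" by (rule add)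
  show "(c *\<^sub>C x) * z = c *\<^sub>C (x * z)" by (rule scale)
  have R: "(a \<otimes> b) * y = tensor_lift (\<lambda>c d. (a * c) \<otimes> (b * d)) y"
    for a :: 'a and b :: 'b and y
    by (simp add: times_tensor_def cbilinear_times_tensor)
  show "z * (x + y) = z * x + z * y"
    by (induction z rule: tensor_induct)
      (simp_all add: R clinear_add[OF clinear_tensor_lift[OF cbilinear_tens_times(1)]] add scale
        cvec.scale_right_distrib)
  show "z * (c *\<^sub>C x) = c *\<^sub>C (z * x)"
    by (induction z rule: tensor_induct)
      (simp_all add: R clinear_scale[OF clinear_tensor_lift[OF cbilinear_tens_times(1)]] add scale
        cvec.scale_right_distrib mult.commute)
qed

instance
proof
  fix x y z :: "('a, 'b) tensor" and c :: complex
  show "(x * y) * z = x * (y * z)"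
  proof (induction x rule: tensor_induct)
    case (tens a b)
    show ?case
    proof (induction y rule: tensor_induct)
      case (tens a' b')
      show ?case
        by (induction z rule: tensor_induct) (simp_all add: tens_times_tens tensor_times_simps mult.assoc)
    qed (simp_all add: tensor_times_simps)
  qed (simp_all add: tensor_times_simps)
  show "1 * x = x"
    by (induction x rule: tensor_induct) (simp_all add: one_tensor_def tens_times_tens tensor_times_simps)
  show "x * 1 = x"
    by (induction x rule: tensor_induct) (simp_all add: one_tensor_def tens_times_tens tensor_times_simps)
qed (simp_all add: tensor_times_simps)

end

section \<open>The tensor algebra \<open>T(V)\<close> and its augmentation ideal \<open>T\<^sub>+(V)\<close>\<close>

text \<open>\<open>T(V)\<close> is the free vector space on all finite words over \<open>V\<close> modulo linearity in each letter.\<close>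

definition talg_rels :: "('v::complex_vector list \<Rightarrow>\<^sub>0 complex) set"
  where "talg_rels =
    {gen (xs @ (a + b) # ys) - gen (xs @ a # ys) - gen (xs @ b # ys) | xs a b ys. True} \<union>
    {gen (xs @ (c *\<^sub>C a) # ys) - c *\<^sub>C gen (xs @ a # ys) | xs c a ys. True}"

quotient_type (overloaded) 'v talg =
  "('v::complex_vector) list \<Rightarrow>\<^sub>0 complex" / "\<lambda>p q. p - q \<in> cvec.span talg_rels"
  by (rule equivp_span)

instantiation talg :: (complex_vector) complex_vector
begin
lift_definition zero_talg :: "'a talg" is 0 .
lift_definition plus_talg :: "'a talg \<Rightarrow> 'a talg \<Rightarrow> 'a talg"
  is "(+)" by (rule span_congs)
lift_definition minus_talg :: "'a talg \<Rightarrow> 'a talg \<Rightarrow> 'a talg"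
  is "(-)" by (rule span_congs)
lift_definition uminus_talg :: "'a talg \<Rightarrow> 'a talg"
  is uminus by (rule span_congs)
lift_definition scaleC_talg :: "complex \<Rightarrow> 'a talg \<Rightarrow> 'a talg"
  is scaleC by (rule span_congs)
instance
  by standard (transfer; simp add: cvec.span_zero algebra_simps scaleC_add_right
      scaleC_add_left scaleC_scaleC scaleC_one)+
end

lift_definition pure :: "'v::complex_vector list \<Rightarrow> 'v talg" is gen .

definition multilinear :: "('v::complex_vector list \<Rightarrow> 'u::complex_vector) \<Rightarrow> bool"
  where "multilinear h \<longleftrightarrow> (\<forall>xs ys. clinear (\<lambda>a. h (xs @ a # ys)))"

text \<open>The map out of the tensor algebra induced by \<open>h\<close>; as for \<open>tensor_lift\<close>, it is
  meaningful only for multilinear \<open>h\<close>.\<close>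

definition talg_lift :: "('v::complex_vector list \<Rightarrow> 'u::complex_vector) \<Rightarrow> 'v talg \<Rightarrow> 'u"
  where "talg_lift h x = free_lift h (rep_talg x)"

lemma talg_lift_abs:
  assumes "multilinear h"
  shows "talg_lift h (abs_talg p) = free_lift h p"
  unfolding talg_lift_def
proof (rule free_lift_eq_if_diff_in_span)
  show "rep_talg (abs_talg p) - p \<in> cvec.span talg_rels"
    using talg.abs_eq_iff[of "rep_talg (abs_talg p)" p] Quotient3_abs_rep[OF Quotient3_talg] by blast
  fix r :: "'a list \<Rightarrow>\<^sub>0 complex"
  assume "r \<in> talg_rels"
  then show "free_lift h r = 0"
    using assms unfolding talg_rels_def multilinear_def clinear_iff
    by (auto simp: clinear_diff[OF clinear_free_lift] clinear_scale[OF clinear_free_lift])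
qed

lemma talg_lift_pure [simp]: "multilinear h \<Longrightarrow> talg_lift h (pure xs) = h xs"
  by (simp add: pure.abs_eq talg_lift_abs)

lemma clinear_talg_lift:
  assumes "multilinear h" shows "clinear (talg_lift h)"
proof -
  have "talg_lift h (x + y) = talg_lift h x + talg_lift h y" for x y
    by (induction x rule: talg.abs_induct; induction y rule: talg.abs_induct) (simp add: plus_talg.abs_eq talg_lift_abs[OF assms]
        clinear_add[OF clinear_free_lift])
  moreover have "talg_lift h (c *\<^sub>C x) = c *\<^sub>C talg_lift h x" for c x
    by (induction x rule: talg.abs_induct) (simp add: scaleC_talg.abs_eq talg_lift_abs[OF assms]
        clinear_scale[OF clinear_free_lift])
  ultimately show ?thesis by (auto simp: clinear_iff)
qed

lemma talg_induct [case_names pure add scale]: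
  assumes "\<And>xs. P (pure xs)" "\<And>x y. P x \<Longrightarrow> P y \<Longrightarrow> P (x + y)" "\<And>c x. P x \<Longrightarrow> P (c *\<^sub>C x)"
  shows "P x"
proof (induction x rule: talg.abs_induct)
  fix p
  show "P (abs_talg p)"
  proof (induction p rule: free_induct)
    case (gen b)
    then show ?case using assms(1) by (metis pure.abs_eq)
  next
    case (add p q)
    then show ?case using assms(2) by (metis plus_talg.abs_eq)
  next
    case (scale c p)
    then show ?case using assms(3) by (metis scaleC_talg.abs_eq)
  qed
qed

lemma multilinear_pure: "multilinear pure"
proof -
  have "pure (xs @ (a + b) # ys) = pure (xs @ a # ys) + pure (xs @ b # ys)"
    for xs ys and a b :: 'a
  proof transfer
    fix xs ys and a b :: 'a
    have "gen (xs @ (a + b) # ys) - gen (xs @ a # ys) - gen (xs @ b # ys) \<in> cvec.span talg_rels"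
      by (rule cvec.span_base) (unfold talg_rels_def, blast)
    then show "gen (xs @ (a + b) # ys) - (gen (xs @ a # ys) + gen (xs @ b # ys))
        \<in> cvec.span talg_rels"
      by (simp add: diff_diff_eq)
  qed
  moreover have "pure (xs @ (c *\<^sub>C a) # ys) = c *\<^sub>C pure (xs @ a # ys)"
    for xs ys c and a :: 'a
    by transfer (rule cvec.span_base, unfold talg_rels_def, blast)
  ultimately show ?thesis by (auto simp: multilinear_def clinear_iff)
qed

lemma multilinear_append:
  assumes "multilinear h"
  shows "multilinear (\<lambda>v. h (u @ v))" "multilinear (\<lambda>u. h (u @ v))"
proof -
  have h: "clinear (\<lambda>a. h (xs @ a # ys))" for xs ys
    using assms by (simp add: multilinear_def)
  show "multilinear (\<lambda>v. h (u @ v))"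
    unfolding multilinear_def using h[of "u @ _"] by simp
  show "multilinear (\<lambda>u. h (u @ v))"
    unfolding multilinear_def using h[of _ "_ @ v"] by simp
qed

text \<open>The product is concatenation of words.\<close>

instantiation talg :: (complex_vector) complex_algebra_1
begin

definition one_talg :: "'a talg" where "one_talg = pure []"

definition times_talg :: "'a talg \<Rightarrow> 'a talg \<Rightarrow> 'a talg"
  where "times_talg x y = talg_lift (\<lambda>u. talg_lift (\<lambda>v. pure (u @ v)) y) x"

lemma multilinear_times_talg: "multilinear (\<lambda>u. talg_lift (\<lambda>v. pure (u @ v)) (y :: 'a talg))"
proof (induction y rule: talg_induct)
  case (pure v)
  show ?case by (simp add: multilinear_append multilinear_pure)
next
  case (add x y)
  then show ?case
    by (simp add: clinear_add[OF clinear_talg_lift[OF multilinear_append(1)[OF multilinear_pure]]]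
        multilinear_def clinear_add_fun)
next
  case (scale c x)
  then show ?case
    by (simp add: clinear_scale[OF clinear_talg_lift[OF multilinear_append(1)[OF multilinear_pure]]]
        multilinear_def clinear_scale_fun)
qed

lemma pure_times_pure: "pure u * pure v = (pure (u @ v) :: 'a talg)"
  by (simp add: times_talg_def multilinear_times_talg multilinear_append multilinear_pure)

lemma talg_times_simps:
  "(x + y) * z = x * z + y * (z :: 'a talg)"
  "z * (x + y) = z * x + z * (y :: 'a talg)"
  "(c *\<^sub>C x) * z = c *\<^sub>C (x * (z :: 'a talg))"
  "z * (c *\<^sub>C x) = c *\<^sub>C (z * (x :: 'a talg))"
proof -
  note L = clinear_talg_lift[OF multilinear_times_talg]
  note R' = clinear_talg_lift[OF multilinear_append(1)[OF multilinear_pure]]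
  have add: "(x + y) * z = x * z + y * z" for x y z :: "'a talg"
    unfolding times_talg_def by (rule clinear_add[OF L])
  have scale: "(c *\<^sub>C x) * z = c *\<^sub>C (x * z)" for c and x z :: "'a talg"
    unfolding times_talg_def by (rule clinear_scale[OF L])
  show "(x + y) * z = x * z + y * z" by (rule add)
  show "(c *\<^sub>C x) * z = c *\<^sub>C (x * z)" by (rule scale)
  have R: "pure u * y = talg_lift (\<lambda>v. pure (u @ v)) y" for u and y :: "'a talg"
    by (simp add: times_talg_def multilinear_times_talg)
  show "z * (x + y) = z * x + z * y"
    by (induction z rule: talg_induct)
      (simp_all add: R clinear_add[OF R'] add scale cvec.scale_right_distrib)
  show "z * (c *\<^sub>C x) = c *\<^sub>C (z * x)"
    by (induction z rule: talg_induct)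
      (simp_all add: R clinear_scale[OF R'] add scale cvec.scale_right_distrib mult.commute)
qed

instance
proof
  fix x y z :: "'a talg" and c :: complex
  show "(x * y) * z = x * (y * z)"
  proof (induction x rule: talg_induct)
    case (pure u)
    show ?case
    proof (induction y rule: talg_induct)
      case (pure v)
      show ?case
        by (induction z rule: talg_induct) (simp_all add: pure_times_pure talg_times_simps)
    qed (simp_all add: talg_times_simps)
  qed (simp_all add: talg_times_simps)
  show "1 * x = x"
    by (induction x rule: talg_induct) (simp_all add: one_talg_def pure_times_pure talg_times_simps)
  show "x * 1 = x"
    by (induction x rule: talg_induct) (simp_all add: one_talg_def pure_times_pure talg_times_simps)
qed (simp_all add: talg_times_simps)

end

typedef (overloaded) 'v tplus =
  "cvec.span {pure xs | xs :: 'v::complex_vector list. xs \<noteq> []}"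
  by (rule exI[of _ 0]) (rule cvec.span_zero)

setup_lifting type_definition_tplus

instantiation tplus :: (complex_vector) complex_vector
begin
lift_definition zero_tplus :: "'a tplus" is 0 by (rule cvec.span_zero)
lift_definition plus_tplus :: "'a tplus \<Rightarrow> 'a tplus \<Rightarrow> 'a tplus" is "(+)" by (rule cvec.span_add)
lift_definition minus_tplus :: "'a tplus \<Rightarrow> 'a tplus \<Rightarrow> 'a tplus" is "(-)" by (rule cvec.span_diff)
lift_definition uminus_tplus :: "'a tplus \<Rightarrow> 'a tplus" is uminus by (rule cvec.span_neg)
lift_definition scaleC_tplus :: "complex \<Rightarrow> 'a tplus \<Rightarrow> 'a tplus" is scaleC by (rule cvec.span_scale)
instance
  by standard (transfer; simp add: algebra_simps scaleC_add_right
      scaleC_add_left scaleC_scaleC scaleC_one)+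
end

text \<open>The element \<open>a\<^sub>1 \<otimes> \<dots> \<otimes> a\<^sub>n\<close> of \<open>T\<^sub>+(V)\<close> given by a word; the empty word, which
  does not belong to \<open>T\<^sub>+(V)\<close>, is sent to \<open>0\<close> and never used.\<close>

lift_definition word :: "'v::complex_vector list \<Rightarrow> 'v tplus"
  is "\<lambda>xs. if xs = [] then 0 else pure xs"
  by (auto intro: cvec.span_zero cvec.span_base)

definition tplus_lift :: "('v::complex_vector list \<Rightarrow> 'u::complex_vector) \<Rightarrow> 'v tplus \<Rightarrow> 'u"
  where "tplus_lift h x = talg_lift h (Rep_tplus x)"

lemma clinear_Rep_tplus: "clinear Rep_tplus"
  by (auto simp: clinear_iff plus_tplus.rep_eq scaleC_tplus.rep_eq)

lemma clinear_tplus_lift: "multilinear h \<Longrightarrow> clinear (tplus_lift h)"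
  unfolding tplus_lift_def by (rule clinear_compose[OF clinear_Rep_tplus clinear_talg_lift])

lemma tplus_lift_word [simp]: "multilinear h \<Longrightarrow> xs \<noteq> [] \<Longrightarrow> tplus_lift h (word xs) = h xs"
  by (simp add: tplus_lift_def word.rep_eq)

lemma tplus_induct [case_names word add scale]:
  assumes "\<And>xs. xs \<noteq> [] \<Longrightarrow> P (word xs)" "\<And>x y. P x \<Longrightarrow> P y \<Longrightarrow> P (x + y)"
    "\<And>c x. P x \<Longrightarrow> P (c *\<^sub>C x)"
  shows "P x"
proof -
  have "y \<in> cvec.span {pure xs | xs. xs \<noteq> []} \<Longrightarrow>
      y \<in> cvec.span {pure xs | xs. xs \<noteq> []} \<and> P (Abs_tplus y)" for y
  proof (induction rule: cvec.span_induct_alt)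
    case base
    have "P (0 *\<^sub>C word [0])" using assms(1,3) by blast
    then show ?case by (simp add: zero_tplus_def cvec.span_zero)
  next
    case (step c z y)
    then obtain xs where z: "z = pure xs" "xs \<noteq> []" by auto
    have "P (c *\<^sub>C word xs + Abs_tplus y)" using assms z step by blast
    moreover have "c *\<^sub>C z + y \<in> cvec.span {pure xs | xs. xs \<noteq> []}"
      using z step by (intro cvec.span_add cvec.span_scale) (auto intro: cvec.span_base)
    moreover have "Abs_tplus (c *\<^sub>C z + y) = c *\<^sub>C word xs + Abs_tplus y"
      using step z calculation(2)
      by (intro Rep_tplus_inject[THEN iffD1])
        (simp add: Abs_tplus_inverse plus_tplus.rep_eq scaleC_tplus.rep_eq word.rep_eq)
    ultimately show ?case by simp
  qed
  from this[OF Rep_tplus[of x]] show ?thesis by (simp add: Rep_tplus_inverse)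
qed

lemma clinear_word: "clinear (\<lambda>a. word (xs @ a # ys))"
  using multilinear_pure[where 'a='a]
  by (auto simp: clinear_iff multilinear_def Rep_tplus_inject[symmetric] word.rep_eq
      plus_tplus.rep_eq scaleC_tplus.rep_eq)

section \<open>The double tensor Hopf algebra\<close>

type_synonym 'a dtalg = "'a tplus talg"

text \<open>The element \<open>w\<^sub>1|\<dots>|w\<^sub>m\<close>. Empty words among the \<open>w\<^sub>i\<close> are read as the unit.\<close>

definition bars :: "'a::complex_vector list list \<Rightarrow> 'a dtalg"
  where "bars ws = pure (map word (filter (\<lambda>w. w \<noteq> []) ws))"

text \<open>
  Positions in a word are counted from \<open>0\<close>, so \<open>[n]\<close> becomes \<open>{0..<n}\<close> and \<open>w\<^sub>S\<close> is \<open>nths w S\<close>.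
  The left end points of the connected components of \<open>C\<close> are the elements of \<open>C\<close> whose
  predecessor is not in \<open>C\<close>, that is, \<open>C - Suc ` C\<close>.
\<close>

definition component_at :: "nat set \<Rightarrow> nat \<Rightarrow> nat set"
  where "component_at C i = {j. i \<le> j \<and> {i..j} \<subseteq> C}"

definition components :: "nat set \<Rightarrow> nat set list"
  where "components C = map (component_at C) (sorted_list_of_set (C - Suc ` C))"

definition Delta_term :: "nat set \<Rightarrow> 'a::complex_vector list \<Rightarrow> ('a dtalg, 'a dtalg) tensor"
  where "Delta_term S w = bars [nths w S] \<otimes> bars (map (nths w) (components ({0..<length w} - S)))"

definition Delta_word :: "'a::complex_vector list \<Rightarrow> ('a dtalg, 'a dtalg) tensor"
  where "Delta_word w = (\<Sum>S \<in> Pow {0..<length w}. Delta_term S w)"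

definition Delta_prec_word :: "'a::complex_vector list \<Rightarrow> ('a dtalg, 'a dtalg) tensor"
  where "Delta_prec_word w = (\<Sum>S \<in> {S. S \<subseteq> {0..<length w} \<and> 0 \<in> S}. Delta_term S w)"

definition Delta_succ_word :: "'a::complex_vector list \<Rightarrow> ('a dtalg, 'a dtalg) tensor"
  where "Delta_succ_word w = (\<Sum>S \<in> {S. S \<subseteq> {0..<length w} \<and> 0 \<notin> S}. Delta_term S w)"

definition Delta :: "'a::complex_vector dtalg \<Rightarrow> ('a dtalg, 'a dtalg) tensor"
  where "Delta = talg_lift (\<lambda>ws. prod_list (map (tplus_lift Delta_word) ws))"

text \<open>The half-coproducts live on the augmentation ideal; they are extended by \<open>0\<close> to the unit.\<close>

definition Delta_prec :: "'a::complex_vector dtalg \<Rightarrow> ('a dtalg, 'a dtalg) tensor"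
  where "Delta_prec = talg_lift (\<lambda>ws. case ws of [] \<Rightarrow> 0
    | w # ws' \<Rightarrow> tplus_lift Delta_prec_word w * Delta (pure ws'))"

definition Delta_succ :: "'a::complex_vector dtalg \<Rightarrow> ('a dtalg, 'a dtalg) tensor"
  where "Delta_succ = talg_lift (\<lambda>ws. case ws of [] \<Rightarrow> 0
    | w # ws' \<Rightarrow> tplus_lift Delta_succ_word w * Delta (pure ws'))"

definition counit :: "'a::complex_vector dtalg \<Rightarrow> complex"
  where "counit = talg_lift (\<lambda>ws. if ws = [] then 1 else 0)"

subsection \<open>Well-definedness of the coproducts\<close>

lemma bars_append: "bars (us @ vs) = bars us * bars vs"
  by (simp add: bars_def pure_times_pure)

lemma bars_word: "w \<noteq> [] \<Longrightarrow> bars [w] = pure [word w]"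
  by (simp add: bars_def)

lemma component_at_disjoint:
  assumes "i \<in> C - Suc ` C" "i' \<in> C - Suc ` C" "j \<in> component_at C i" "j \<in> component_at C i'"
  shows "i = i'"
proof -
  have aux: False
    if "i < i'" "i' \<in> C - Suc ` C" "j \<in> component_at C i" "j \<in> component_at C i'" for i i'
  proof -
    have lt: "i < i'" by (rule that(1))
    obtain k where k: "i' = Suc k" using lt by (rule lessE)
    have "i' \<le> j" "{i..j} \<subseteq> C" using that(3,4) by (simp_all add: component_at_def)
    then have "k \<in> C" using k that(1) by (intro subsetD[of "{i..j}" C k]) simp_all
    then show False using that(2) k by simp
  qed
  show ?thesis
  proof (rule ccontr)
    assume "i \<noteq> i'"
    then consider "i < i'" | "i' < i" by linarith
    then show False using aux[of i i'] aux[of i' i] assms by cases simp_all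
  qed
qed

lemma component_at_cover:
  assumes "k \<in> C"
  obtains i where "i \<in> C - Suc ` C" "k \<in> component_at C i"
proof -
  define i where "i = (LEAST i. {i..k} \<subseteq> C)"
  have P: "{k..k} \<subseteq> C" using assms by simp
  have i: "{i..k} \<subseteq> C" unfolding i_def by (rule LeastI[of "\<lambda>i. {i..k} \<subseteq> C", OF P])
  have le: "i \<le> k" unfolding i_def by (rule Least_le[of "\<lambda>i. {i..k} \<subseteq> C", OF P])
  have "i \<notin> Suc ` C"
  proof
    assume "i \<in> Suc ` C"
    then obtain j where j: "i = Suc j" "j \<in> C" by blast
    moreover have "{j..k} = insert j {Suc j..k}" using j le by (intro Icc_eq_insert_lb_nat) simp
    ultimately have "{j..k} \<subseteq> C" using i by simp
    then have "i \<le> j" unfolding i_def by (rule Least_le)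
    then show False using j by simp
  qed
  moreover have "i \<in> C" using i le by auto
  ultimately show ?thesis using that[of i] i le by (auto simp: component_at_def)
qed

lemma components_split:
  assumes "finite C" "k \<in> C"
  obtains Js J Ks where "components C = Js @ J # Ks" "k \<in> J" "\<forall>K\<in>set (Js @ Ks). k \<notin> K"
proof -
  obtain i where i: "i \<in> C - Suc ` C" "k \<in> component_at C i"
    using component_at_cover[OF assms(2)] .
  have set: "set (sorted_list_of_set (C - Suc ` C)) = C - Suc ` C"
    using assms by simp
  then obtain as bs where ab: "sorted_list_of_set (C - Suc ` C) = as @ i # bs"
    using i(1) by (metis split_list)
  have "distinct (as @ i # bs)" using ab by (metis distinct_sorted_list_of_set)
  moreover have "set (as @ i # bs) = C - Suc ` C" using set ab by simp
  ultimately have "\<forall>j\<in>set (as @ bs). k \<notin> component_at C j"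
  proof (intro ballI notI)
    fix j assume j: "j \<in> set (as @ bs)" "k \<in> component_at C j"
    have "j \<in> C - Suc ` C" using j(1) \<open>set (as @ i # bs) = C - Suc ` C\<close> by auto
    then have "i = j" using component_at_disjoint i j(2) by blast
    then show False using j(1) \<open>distinct (as @ i # bs)\<close> by auto
  qed
  then show ?thesis
    using that[of "map (component_at C) as" "component_at C i" "map (component_at C) bs"] i(2) ab
    by (auto simp: components_def)
qed

lemma components_subset: "K \<in> set (components C) \<Longrightarrow> K \<subseteq> C"
  by (force simp: components_def component_at_def)

lemma nths_middle:
  "nths (xs @ a # ys) T =
    nths xs T @ (if length xs \<in> T then [a] else []) @ nths ys {j. Suc (j + length xs) \<in> T}"
  by (simp add: nths_append nths_Cons)

lemma multilinear_Delta_term: "multilinear (Delta_term S)"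
  unfolding multilinear_def
proof (intro allI)
  fix xs ys :: "'a list"
  let ?k = "length xs"
  let ?C = "{0..<length xs + Suc (length ys)} - S"
  have const: "nths (xs @ a # ys) T = nths (xs @ 0 # ys) T" if "?k \<notin> T" for a T
    using that by (simp add: nths_middle)
  have lin: "clinear (\<lambda>a. bars [nths (xs @ a # ys) T])" if "?k \<in> T" for T
  proof -
    have "clinear (\<lambda>x :: 'a tplus. pure [x])"
      using multilinear_pure[unfolded multilinear_def, rule_format, of "[]" "[]"] by simp
    moreover have "bars [nths (xs @ a # ys) T] =
        pure [word (nths xs T @ a # nths ys {j. Suc (j + length xs) \<in> T})]" for a
      using that by (simp add: nths_middle bars_word)
    ultimately show ?thesis using clinear_compose[OF clinear_word] by simp
  qed
  have eq: "Delta_term S (xs @ a # ys) = bars [nths (xs @ a # ys) S] \<otimes>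
      bars (map (nths (xs @ a # ys)) (components ?C))" for a
    by (simp add: Delta_term_def)
  have tens: "clinear (\<lambda>x :: 'a dtalg. x \<otimes> y)" "clinear (\<lambda>x :: 'a dtalg. y \<otimes> x)" for y :: "'a dtalg"
    by (simp_all add: cbilinear_tens[unfolded cbilinear_def])
  show "clinear (\<lambda>a. Delta_term S (xs @ a # ys))"
  proof (cases "?k \<in> S")
    case True
    have "map (nths (xs @ a # ys)) (components ?C) = map (nths (xs @ 0 # ys)) (components ?C)" for a
      using components_subset[of _ ?C] True by (intro map_cong refl const) auto
    then have "Delta_term S (xs @ a # ys) = bars [nths (xs @ a # ys) S] \<otimes>
        bars (map (nths (xs @ 0 # ys)) (components ?C))" for a
      by (metis eq)
    then show ?thesis
      using clinear_compose[OF lin[OF True] tens(1)] by presburger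
  next
    case False
    then have "?k \<in> ?C" by simp
    then obtain Js J Ks where J: "components ?C = Js @ J # Ks" "?k \<in> J"
      "\<forall>K\<in>set (Js @ Ks). ?k \<notin> K"
      using components_split[of ?C ?k] by auto
    have "bars (map (nths (xs @ a # ys)) (components ?C)) =
        bars (map (nths (xs @ 0 # ys)) Js) * (bars [nths (xs @ a # ys) J] *
        bars (map (nths (xs @ 0 # ys)) Ks))" for a
    proof -
      have "map (nths (xs @ a # ys)) Js = map (nths (xs @ 0 # ys)) Js"
        "map (nths (xs @ a # ys)) Ks = map (nths (xs @ 0 # ys)) Ks"
        using J(3) by (auto intro!: const)
      then have "map (nths (xs @ a # ys)) (components ?C) = map (nths (xs @ 0 # ys)) Js @
          ([nths (xs @ a # ys) J] @ map (nths (xs @ 0 # ys)) Ks)"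
        unfolding J(1) by simp
      then show ?thesis by (simp only: bars_append)
    qed
    moreover have "clinear (\<lambda>a. bars (map (nths (xs @ 0 # ys)) Js) * (bars [nths (xs @ a # ys) J] *
        bars (map (nths (xs @ 0 # ys)) Ks)))"
      by (rule clinear_compose[OF clinear_compose[OF lin[OF J(2)] clinear_times_left] clinear_times_right])
    ultimately have "clinear (\<lambda>a. bars (map (nths (xs @ a # ys)) (components ?C)))"
      by simp
    then have "clinear (\<lambda>a. bars [nths (xs @ 0 # ys) S] \<otimes>
        bars (map (nths (xs @ a # ys)) (components ?C)))"
      by (rule clinear_compose[OF _ tens(2)])
    moreover have "Delta_term S (xs @ a # ys) = bars [nths (xs @ 0 # ys) S] \<otimes>
        bars (map (nths (xs @ a # ys)) (components ?C))" for a
      by (metis eq const[OF False])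
    ultimately show ?thesis by presburger
  qed
qed

lemma multilinear_Delta_word:
  "multilinear Delta_word" "multilinear Delta_prec_word" "multilinear Delta_succ_word"
  using multilinear_Delta_term
  unfolding multilinear_def Delta_word_def Delta_prec_word_def Delta_succ_word_def
  by (auto intro!: clinear_sum_fun)

lemma multilinear_prod_list:
  fixes f :: "'a::complex_vector \<Rightarrow> 'b::complex_algebra_1"
  assumes "clinear f"
  shows "multilinear (\<lambda>ws. prod_list (map f ws))"
  unfolding multilinear_def
  using clinear_compose[OF clinear_compose[OF assms clinear_times_left] clinear_times_right]
  by simp

lemma Delta_pure: "Delta (pure ws) = prod_list (map (tplus_lift Delta_word) ws)"
  by (simp add: Delta_def multilinear_prod_list clinear_tplus_lift multilinear_Delta_word)

lemma clinear_Delta: "clinear Delta"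
  unfolding Delta_def
  by (intro clinear_talg_lift multilinear_prod_list clinear_tplus_lift multilinear_Delta_word)

lemma Delta_one: "Delta 1 = 1"
  by (simp add: one_talg_def Delta_pure)

lemma Delta_mult: "Delta (x * y) = Delta x * Delta y"
proof (induction x rule: talg_induct)
  case (pure u)
  show ?case
  proof (induction y rule: talg_induct)
    case (pure v)
    show ?case by (simp add: pure_times_pure Delta_pure)
  qed (simp_all add: algebra_simps mult_scaleC_right clinear_add[OF clinear_Delta] clinear_scale[OF clinear_Delta])
qed (simp_all add: algebra_simps mult_scaleC_left clinear_add[OF clinear_Delta] clinear_scale[OF clinear_Delta])

lemma Delta_single: "w \<noteq> [] \<Longrightarrow> Delta (pure [word w]) = Delta_word w"
  by (simp add: Delta_pure multilinear_Delta_word)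

lemma multilinear_case_list:
  fixes f :: "'v::complex_vector \<Rightarrow> 'b::complex_algebra_1"
  assumes "clinear f" "multilinear g"
  shows "multilinear (\<lambda>ws. case ws of [] \<Rightarrow> 0 | w # ws' \<Rightarrow> f w * g ws')"
  unfolding multilinear_def
proof (intro allI)
  fix xs ys :: "'v list"
  show "clinear (\<lambda>a. case xs @ a # ys of [] \<Rightarrow> 0 | w # ws' \<Rightarrow> f w * g ws')"
  proof (cases xs)
    case Nil
    then show ?thesis using clinear_compose[OF assms(1) clinear_times_left] by simp
  next
    case (Cons x xs')
    have "clinear (\<lambda>a. g (xs' @ a # ys))" using assms(2) by (simp add: multilinear_def)
    then show ?thesis using Cons clinear_compose[OF _ clinear_times_right] by simp
  qed
qed

lemma multilinear_Delta_pure: "multilinear (\<lambda>ws. Delta (pure ws))"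
  unfolding Delta_pure by (intro multilinear_prod_list clinear_tplus_lift multilinear_Delta_word)

lemma clinear_Delta_prec: "clinear Delta_prec"
  and clinear_Delta_succ: "clinear Delta_succ"
  unfolding Delta_prec_def Delta_succ_def
  by (intro clinear_talg_lift multilinear_case_list clinear_tplus_lift multilinear_Delta_word
      multilinear_Delta_pure)+

lemma Delta_prec_pure:
    "Delta_prec (pure (w # ws)) = tplus_lift Delta_prec_word w * Delta (pure ws)"
  and Delta_succ_pure:
    "Delta_succ (pure (w # ws)) = tplus_lift Delta_succ_word w * Delta (pure ws)"
  and Delta_prec_one: "Delta_prec 1 = 0"
  and Delta_succ_one: "Delta_succ 1 = 0"
  unfolding Delta_prec_def Delta_succ_def one_talg_def
  by (simp_all add: multilinear_case_list clinear_tplus_lift multilinear_Delta_word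
      multilinear_Delta_pure)

lemma Delta_word_split: "w \<noteq> [] \<Longrightarrow> Delta_word w = Delta_prec_word w + Delta_succ_word w"
  unfolding Delta_word_def Delta_prec_word_def Delta_succ_word_def
  by (subst sum.union_disjoint[symmetric]) (auto intro: sum.cong)

lemma multilinear_counit:
  "multilinear (\<lambda>ws::'a::complex_vector list. if ws = [] then 1 else 0 :: complex)"
  by (simp add: multilinear_def clinear_zero_fun)

lemma counit_pure: "counit (pure ws) = (if ws = [] then 1 else 0)"
  by (simp add: counit_def multilinear_counit)

section \<open>Products on the dual\<close>

text \<open>\<open>m\<^sub>\<complex> \<circ> (f \<otimes> g)\<close>, for linear forms \<open>f\<close> and \<open>g\<close>.\<close>

definition tensor_form ::
  "('v::complex_vector \<Rightarrow> complex) \<Rightarrow> ('w::complex_vector \<Rightarrow> complex) \<Rightarrow> ('v, 'w) tensor \<Rightarrow> complex"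
  where "tensor_form f g = tensor_lift (\<lambda>a b. f a * g b)"

lemma tensor_form_tens: "clinear f \<Longrightarrow> clinear g \<Longrightarrow> tensor_form f g (a \<otimes> b) = f a * g b"
  unfolding tensor_form_def
  by (rule tensor_lift_tens)
    (auto simp: cbilinear_def intro!: clinear_compose[OF _ clinear_times_left]
      clinear_compose[OF _ clinear_times_right])

type_synonym 'a form = "'a dtalg \<Rightarrow> complex"

definition conv :: "'a::complex_vector form \<Rightarrow> 'a form \<Rightarrow> 'a form" (infixl "\<star>" 70)
  where "f \<star> g = (\<lambda>x. tensor_form f g (Delta x))"

text \<open>
  Since the half-coproducts vanish on the unit, so do \<open>f \<prec> g\<close> and \<open>f \<succ> g\<close>. In particular
  the conventions \<open>f \<prec> counit = f = counit \<succ> f\<close> and \<open>counit \<prec> f = 0 = f \<succ> counit\<close>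
  hold for linear forms \<open>f\<close> that vanish on the unit.
\<close>

definition half_prec :: "'a::complex_vector form \<Rightarrow> 'a form \<Rightarrow> 'a form" (infixl "\<prec>" 70)
  where "f \<prec> g = (\<lambda>x. tensor_form f g (Delta_prec x))"

definition half_succ :: "'a::complex_vector form \<Rightarrow> 'a form \<Rightarrow> 'a form" (infixl "\<succ>" 70)
  where "f \<succ> g = (\<lambda>x. tensor_form f g (Delta_succ x))"

definition characters :: "'a::complex_vector form set"
  where "characters = {\<Phi>. clinear \<Phi> \<and> \<Phi> 1 = 1 \<and> (\<forall>x y. \<Phi> (x * y) = \<Phi> x * \<Phi> y)}"

definition infinitesimal_characters :: "'a::complex_vector form set"
  where "infinitesimal_characters =
    {\<alpha>. clinear \<alpha> \<and> \<alpha> 1 = 0 \<and> (\<forall>ws :: 'a tplus list. length ws \<ge> 2 \<longrightarrow> \<alpha> (pure ws) = 0)}"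

definition char_inverse :: "'a::complex_vector form \<Rightarrow> 'a form"
  where "char_inverse \<Psi> =
    (THE \<Theta>. \<Theta> \<in> characters \<and> \<Theta> \<star> \<Psi> = counit \<and> \<Psi> \<star> \<Theta> = counit)"

primrec succ_power :: "'a::complex_vector form \<Rightarrow> nat \<Rightarrow> 'a form"
  where
    "succ_power \<alpha> 0 = counit"
  | "succ_power \<alpha> (Suc n) = succ_power \<alpha> n \<succ> \<alpha>"

text \<open>For an infinitesimal character \<open>\<alpha>\<close>, the sum has only finitely many nonzero terms at each \<open>x\<close>.\<close>

definition E_succ :: "'a::complex_vector form \<Rightarrow> 'a form"
  where "E_succ \<alpha> = (\<lambda>x. suminf (\<lambda>n. succ_power \<alpha> n x))"

definition L_succ :: "'a::complex_vector form \<Rightarrow> 'a form"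
  where "L_succ = the_inv_into infinitesimal_characters E_succ"

definition cmon_conv ::
  "'a::complex_vector form \<times> 'a form \<Rightarrow> 'a form \<times> 'a form \<Rightarrow> 'a form \<times> 'a form"
  where "cmon_conv = (\<lambda>(\<Phi>\<^sub>1, \<Psi>\<^sub>1) (\<Phi>\<^sub>2, \<Psi>\<^sub>2).
    let \<beta>\<^sub>1 = L_succ \<Phi>\<^sub>1; \<beta>\<^sub>2 = L_succ \<Phi>\<^sub>2
    in (E_succ (\<lambda>x. \<beta>\<^sub>2 x + (char_inverse \<Psi>\<^sub>2 \<succ> \<beta>\<^sub>1 \<prec> \<Psi>\<^sub>2) x), \<Psi>\<^sub>1 \<star> \<Psi>\<^sub>2))"

end

theory Submission
  imports Defs
begin

text \<open>
  Write \<open>\<beta> \<triangleleft> \<Psi>\<close> for the infinitesimal character \<open>\<Psi>\<^sup>-\<^sup>1 \<succ> \<beta> \<prec> \<Psi>\<close> (\<open>conjugate \<beta> \<Psi>\<close> below). The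
  half-shuffle exponential identifies pairs \<open>(\<Phi>, \<Psi>)\<close> with pairs \<open>(\<beta>, \<Psi>)\<close>, on which the convolution
  becomes \<open>(\<beta>\<^sub>1, \<Psi>\<^sub>1)(\<beta>\<^sub>2, \<Psi>\<^sub>2) = (\<beta>\<^sub>2 + \<beta>\<^sub>1 \<triangleleft> \<Psi>\<^sub>2, \<Psi>\<^sub>1 \<star> \<Psi>\<^sub>2)\<close>. This is the product of a semidirect
  product, so it is associative because \<open>\<triangleleft>\<close> is additive in \<open>\<beta>\<close> (\<open>conjugate_add\<close>) and a right
  action of the group of characters (\<open>conjugate_conjugate\<close>).

  Characters and infinitesimal characters are determined by their values on words, and everything
  is computed there. A function on words is regarded as a non-commutative power series, with
  the deconcatenation product \<open>\<odot>\<close>. For a series \<open>\<chi>\<close>, let \<open>subst \<chi>\<close> be the algebra morphism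
  \<open>a \<mapsto> \<chi> \<cdot> a\<close> on letters. Then, on words,

    \<^item> \<open>f \<star> \<Psi>\<close> is \<open>subst \<Psi> f \<odot> \<Psi>\<close> (\<open>on_words_conv\<close>): the subset of chosen positions in the coproduct
      selects the letters of \<open>f\<close>, and the components are the gaps between them;
    \<^item> \<open>f \<succ> \<beta>\<close> is \<open>\<beta> \<odot> f\<close> (\<open>half_succ_bars_mult\<close>), so that \<open>\<Phi> = E_succ \<beta>\<close> means \<open>\<Phi> = 1 + \<beta> \<odot> \<Phi>\<close>,
      which can be solved for \<open>\<Phi>\<close> and for \<open>\<beta>\<close>;
    \<^item> \<open>\<beta> \<triangleleft> \<Psi>\<close> arises from \<open>\<beta>\<close> by applying \<open>subst \<Psi>\<close> to everything after the first letter
      (\<open>on_words_conjugate\<close>).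

  The substitution \<open>subst \<chi> \<circ> subst \<psi>\<close> sends \<open>a\<close> to \<open>subst \<chi> \<psi> \<cdot> \<chi> \<cdot> a\<close>, whence
  \<open>subst \<chi> \<circ> subst \<psi> = subst (\<psi> \<star> \<chi>)\<close> (\<open>subst_subst\<close>). This gives both the associativity of
  \<open>\<star>\<close> on characters and the action property. Inverses, exponentials and logarithms are obtained as
  solutions of equations that determine a series recursively in the length of words
  (\<open>multilinear_fixed_point\<close>).
\<close>

section \<open>Functions on words as non-commutative power series\<close>

text \<open>The product of non-commutative power series: \<open>(f \<odot> g)(w)\<close> sums \<open>f u * g v\<close> over all
  factorizations \<open>w = uv\<close>. The recursion peels off the first letter, which belongs to \<open>u\<close>
  unless \<open>u\<close> is empty.\<close>

fun dprod :: "('a list \<Rightarrow> complex) \<Rightarrow> ('a list \<Rightarrow> complex) \<Rightarrow> 'a list \<Rightarrow> complex" (infixl "\<odot>" 70)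
  where
    "(f \<odot> g) [] = f [] * g []"
  | "(f \<odot> g) (a # w) = f [] * g (a # w) + ((\<lambda>u. f (a # u)) \<odot> g) w"

text \<open>The counit on words, that is, the unit series \<open>1\<close>.\<close>

definition delta :: "'a list \<Rightarrow> complex" where "delta w = (if w = [] then 1 else 0)"

text \<open>The series \<open>\<Sum>\<^sub>a \<kappa> \<cdot> a \<cdot> G\<^sub>a\<close>: the sum of \<open>\<kappa> u * G a v\<close> over all \<open>w = u a v\<close>.
  For a word \<open>w\<close> this is a finite sum although there may be infinitely many letters.\<close>

fun letter_sum :: "('a list \<Rightarrow> complex) \<Rightarrow> ('a \<Rightarrow> 'a list \<Rightarrow> complex) \<Rightarrow> 'a list \<Rightarrow> complex"
  where
    "letter_sum \<kappa> G [] = 0"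
  | "letter_sum \<kappa> G (a # w) = \<kappa> [] * G a w + letter_sum (\<lambda>u. \<kappa> (a # u)) G w"

text \<open>The recursive call in \<open>subst\<close> below occurs under \<open>letter_sum\<close>; it terminates because only
  words \<open>v\<close> shorter than \<open>w = u a v\<close> are visited.\<close>

lemma letter_sum_cong [fundef_cong]:
  assumes "\<kappa> = \<kappa>'" "w = w'" "\<And>a v. length v < length w' \<Longrightarrow> G a v = G' a v"
  shows "letter_sum \<kappa> G w = letter_sum \<kappa>' G' w'"
proof -
  have "letter_sum \<kappa> G w = letter_sum \<kappa> G' w"
    if "\<And>a v. length v < length w \<Longrightarrow> G a v = G' a v" for w
    using that by (induction w arbitrary: \<kappa>) auto
  then show ?thesis using assms by auto
qed

text \<open>The algebra morphism that replaces each letter \<open>a\<close> of the series \<open>f\<close> by \<open>\<chi> \<cdot> a\<close>: write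
  \<open>f = f [] + \<Sum>\<^sub>a a \<cdot> f\<^sub>a\<close> with \<open>f\<^sub>a u = f (a # u)\<close> and recurse on the \<open>f\<^sub>a\<close>.\<close>

function subst :: "('a list \<Rightarrow> complex) \<Rightarrow> ('a list \<Rightarrow> complex) \<Rightarrow> 'a list \<Rightarrow> complex"
  where "subst \<chi> f w = f [] * delta w + letter_sum \<chi> (\<lambda>a v. subst \<chi> (\<lambda>u. f (a # u)) v) w"
  by pat_completeness auto
termination by (relation "measure (\<lambda>(\<chi>, f, w). length w)") auto

declare subst.simps [simp del]

text \<open>In \<open>f * \<chi>\<close> a factor \<open>\<chi>\<close> is placed in each gap between the chosen letters, before the first
  one and after the last one. Substituting \<open>\<chi> \<cdot> a\<close> for \<open>a\<close> produces every gap but the last,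
  which is the right factor here.\<close>

definition word_conv :: "('a list \<Rightarrow> complex) \<Rightarrow> ('a list \<Rightarrow> complex) \<Rightarrow> 'a list \<Rightarrow> complex"
    (infixl "\<circledast>" 70)
  where "f \<circledast> \<chi> = subst \<chi> f \<odot> \<chi>"

lemma dprod_eq_sum: "(f \<odot> g) w = (\<Sum>k\<le>length w. f (take k w) * g (drop k w))"
  by (induction w arbitrary: f) (simp_all add: sum.atMost_Suc_shift del: sum.atMost_Suc)

lemma dprod_zero_left [simp]: "((\<lambda>u. 0) \<odot> g) w = 0"
  by (induction w) auto

lemma dprod_linear_left:
  "((\<lambda>u. f u + f' u) \<odot> g) w = (f \<odot> g) w + (f' \<odot> g) w"
  "((\<lambda>u. c * f u) \<odot> g) w = c * (f \<odot> g) w"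
  by (induction w arbitrary: f f') (simp_all add: algebra_simps)

lemma dprod_scale_right: "(f \<odot> (\<lambda>v. g v * c)) w = (f \<odot> g) w * c"
  by (induction w arbitrary: f) (simp_all add: algebra_simps)

lemma delta_simps [simp]: "delta [] = 1" "delta (a # w) = 0"
  by (simp_all add: delta_def)

lemma dprod_delta_left [simp]: "delta \<odot> g = g"
proof
  show "(delta \<odot> g) w = g w" for w by (cases w) auto
qed

lemma dprod_delta_right [simp]: "f \<odot> delta = f"
proof
  show "(f \<odot> delta) w = f w" for w by (induction w arbitrary: f) auto
qed

lemma dprod_assoc: "f \<odot> g \<odot> h = f \<odot> (g \<odot> h)"
proof
  show "(f \<odot> g \<odot> h) w = (f \<odot> (g \<odot> h)) w" for w
    by (induction w arbitrary: f) (simp_all add: dprod_linear_left algebra_simps)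
qed

lemma letter_sum_linear_left:
  "letter_sum (\<lambda>u. \<kappa> u + \<kappa>' u) G w = letter_sum \<kappa> G w + letter_sum \<kappa>' G w"
  "letter_sum (\<lambda>u. c * \<kappa> u) G w = c * letter_sum \<kappa> G w"
  by (induction w arbitrary: \<kappa> \<kappa>') (simp_all add: algebra_simps)

lemma letter_sum_linear_right:
  "letter_sum \<kappa> (\<lambda>a v. G a v + H a v) w = letter_sum \<kappa> G w + letter_sum \<kappa> H w"
  "letter_sum \<kappa> (\<lambda>a v. c * G a v) w = c * letter_sum \<kappa> G w"
  "letter_sum \<kappa> (\<lambda>a v. 0) w = 0"
  by (induction w arbitrary: \<kappa>) (simp_all add: algebra_simps)

lemma letter_sum_dprod: "letter_sum \<kappa> G \<odot> h = letter_sum \<kappa> (\<lambda>a. G a \<odot> h)"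
proof
  show "(letter_sum \<kappa> G \<odot> h) w = letter_sum \<kappa> (\<lambda>a. G a \<odot> h) w" for w
    by (induction w arbitrary: \<kappa>) (simp_all add: dprod_linear_left)
qed

lemma letter_sum_letter_sum:
  "letter_sum (letter_sum \<kappa> G) H w = letter_sum \<kappa> (\<lambda>a. letter_sum (G a) H) w"
  by (induction w arbitrary: \<kappa>) (simp_all add: letter_sum_linear_left)

lemma subst_unfold:
  "subst \<chi> f = (\<lambda>w. f [] * delta w + letter_sum \<chi> (\<lambda>a. subst \<chi> (\<lambda>u. f (a # u))) w)"
  by (rule ext) (subst subst.simps, rule refl)

lemma subst_linear:
  "subst \<chi> (\<lambda>u. f u + g u) w = subst \<chi> f w + subst \<chi> g w"
  "subst \<chi> (\<lambda>u. c * f u) w = c * subst \<chi> f w"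
proof -
  show "subst \<chi> (\<lambda>u. f u + g u) w = subst \<chi> f w + subst \<chi> g w"
  proof (induction w arbitrary: f g rule: length_induct)
    case (1 w)
    have "letter_sum \<chi> (\<lambda>a. subst \<chi> (\<lambda>u. f (a # u) + g (a # u))) w =
      letter_sum \<chi> (\<lambda>a v. subst \<chi> (\<lambda>u. f (a # u)) v + subst \<chi> (\<lambda>u. g (a # u)) v) w"
      using 1 by (intro letter_sum_cong) auto
    then show ?case
      unfolding subst_unfold[of _ "\<lambda>u. f u + g u"] subst_unfold[of _ f] subst_unfold[of _ g]
      by (simp add: letter_sum_linear_right algebra_simps)
  qed
  show "subst \<chi> (\<lambda>u. c * f u) w = c * subst \<chi> f w"
  proof (induction w arbitrary: f rule: length_induct)
    case (1 w)
    have "letter_sum \<chi> (\<lambda>a. subst \<chi> (\<lambda>u. c * f (a # u))) w =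
      letter_sum \<chi> (\<lambda>a v. c * subst \<chi> (\<lambda>u. f (a # u)) v) w"
      using 1 by (intro letter_sum_cong) auto
    then show ?case
      unfolding subst_unfold[of _ "\<lambda>u. c * f u"] subst_unfold[of _ f]
      by (simp add: letter_sum_linear_right algebra_simps)
  qed
qed

lemma subst_zero [simp]: "subst \<chi> (\<lambda>u. 0) = (\<lambda>w. 0)"
  using subst_linear(2)[of \<chi> 0 "\<lambda>u. 0"] by (simp add: fun_eq_iff)

lemma subst_delta [simp]: "subst \<chi> delta = delta"
  by (subst subst_unfold) (simp add: letter_sum_linear_right fun_eq_iff)

lemma word_conv_delta_left [simp]: "delta \<circledast> \<chi> = \<chi>"
  by (simp add: word_conv_def)

lemma dprod_diff_left: "((\<lambda>u. f u - f' u) \<odot> g) w = (f \<odot> g) w - (f' \<odot> g) w"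
  by (induction w arbitrary: f f') (simp_all add: algebra_simps)

lemma word_conv_diff_left: "((\<lambda>u. f u - f' u) \<circledast> g) w = (f \<circledast> g) w - (f' \<circledast> g) w"
proof -
  have "subst g (\<lambda>u. f u + (-1) * f' u) = (\<lambda>w. subst g f w - subst g f' w)"
    unfolding fun_eq_iff subst_linear by simp
  then show ?thesis by (simp add: word_conv_def dprod_diff_left)
qed

text \<open>Splitting off the first gap and the first chosen letter. This is the form in which the
  sum over subsets of positions is later recognized.\<close>

lemma word_conv_unfold:
  "f \<circledast> \<chi> = (\<lambda>w. f [] * \<chi> w + letter_sum \<chi> (\<lambda>a. (\<lambda>u. f (a # u)) \<circledast> \<chi>) w)"
  unfolding word_conv_def
  by (subst subst_unfold)
    (auto simp: dprod_linear_left letter_sum_dprod fun_eq_iff)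

lemma word_conv_delta_right: "f \<circledast> delta = f"
proof -
  have zero: "letter_sum (\<lambda>u. 0) G v = 0" for G and v :: "'a list" by (induction v) auto
  have "subst delta f v = f v" for v
  proof (induction v arbitrary: f)
    case Nil
    show ?case by (subst subst_unfold) simp
  next
    case (Cons a v)
    then show ?case by (subst subst_unfold) (simp add: zero)
  qed
  then show ?thesis by (simp add: word_conv_def fun_eq_iff)
qed

text \<open>A morphism sends \<open>\<psi> \<cdot> a \<cdot> G\<^sub>a\<close> to \<open>subst \<chi> \<psi> \<cdot> \<chi> \<cdot> a \<cdot> subst \<chi> G\<^sub>a\<close>, and
  \<open>subst \<chi> \<psi> \<cdot> \<chi> = \<psi> \<circledast> \<chi>\<close>. The induction has to vary \<open>\<psi>\<close>, since removing
  a first letter replaces it by one of its left quotients.\<close>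

lemma subst_letter_sum:
  "subst \<chi> (letter_sum \<psi> G) w = letter_sum (\<psi> \<circledast> \<chi>) (\<lambda>a. subst \<chi> (G a)) w"
proof (induction w arbitrary: \<psi> rule: length_induct)
  case (1 w)
  have "subst \<chi> (letter_sum \<psi> G) w =
      letter_sum \<chi> (\<lambda>b. subst \<chi> (\<lambda>u. \<psi> [] * G b u + letter_sum (\<lambda>u. \<psi> (b # u)) G u)) w"
    by (subst subst_unfold) simp
  also have "\<dots> = letter_sum \<chi> (\<lambda>b v. \<psi> [] * subst \<chi> (G b) v +
      letter_sum ((\<lambda>u. \<psi> (b # u)) \<circledast> \<chi>) (\<lambda>a. subst \<chi> (G a)) v) w"
    using 1 by (intro letter_sum_cong) (auto simp: subst_linear)
  also have "\<dots> = letter_sum (\<psi> \<circledast> \<chi>) (\<lambda>a. subst \<chi> (G a)) w"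
    by (subst word_conv_unfold[of \<psi>])
      (simp add: letter_sum_linear_right letter_sum_linear_left letter_sum_letter_sum)
  finally show ?case .
qed

lemma subst_dprod: "subst \<chi> (f \<odot> g) = subst \<chi> f \<odot> subst \<chi> g"
proof
  show "subst \<chi> (f \<odot> g) w = (subst \<chi> f \<odot> subst \<chi> g) w" for w
  proof (induction w arbitrary: f rule: length_induct)
    case (1 w)
    have "subst \<chi> (f \<odot> g) w = f [] * g [] * delta w +
      letter_sum \<chi> (\<lambda>b. subst \<chi> (\<lambda>u. f [] * g (b # u) + ((\<lambda>u. f (b # u)) \<odot> g) u)) w"
      by (subst subst_unfold) simp
    also have "\<dots> = f [] * g [] * delta w + letter_sum \<chi> (\<lambda>b v.
        f [] * subst \<chi> (\<lambda>u. g (b # u)) v + (subst \<chi> (\<lambda>u. f (b # u)) \<odot> subst \<chi> g) v) w"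
      using 1 by (intro arg_cong2[where f="(+)"] refl letter_sum_cong) (auto simp: subst_linear)
    also have "\<dots> = f [] * subst \<chi> g w +
        letter_sum \<chi> (\<lambda>b. subst \<chi> (\<lambda>u. f (b # u)) \<odot> subst \<chi> g) w"
      by (subst subst_unfold[of _ g]) (simp add: letter_sum_linear_right algebra_simps)
    also have "\<dots> = (subst \<chi> f \<odot> subst \<chi> g) w"
      by (subst subst_unfold[of _ f]) (simp add: dprod_linear_left flip: letter_sum_dprod)
    finally show ?case .
  qed
qed

text \<open>Both sides are morphisms, and on a letter they agree: \<open>subst \<chi> (\<psi> \<cdot> a)\<close> is
  \<open>subst \<chi> \<psi> \<cdot> \<chi> \<cdot> a = (\<psi> \<circledast> \<chi>) \<cdot> a\<close>. This composition law is what makes the twisted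
  action of characters on infinitesimal characters a right action.\<close>

lemma subst_subst: "subst \<chi> (subst \<psi> f) = subst (\<psi> \<circledast> \<chi>) f"
proof
  show "subst \<chi> (subst \<psi> f) w = subst (\<psi> \<circledast> \<chi>) f w" for w
  proof (induction w arbitrary: f rule: length_induct)
    case (1 w)
    have "subst \<chi> (subst \<psi> f) w =
        f [] * delta w + letter_sum (\<psi> \<circledast> \<chi>) (\<lambda>a. subst \<chi> (subst \<psi> (\<lambda>u. f (a # u)))) w"
      by (subst subst_unfold[of \<psi>]) (simp add: subst_linear subst_letter_sum)
    also have "\<dots> = f [] * delta w + letter_sum (\<psi> \<circledast> \<chi>) (\<lambda>a. subst (\<psi> \<circledast> \<chi>) (\<lambda>u. f (a # u))) w"
      using 1 by (intro arg_cong2[where f="(+)"] refl letter_sum_cong) auto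
    also have "\<dots> = subst (\<psi> \<circledast> \<chi>) f w"
      by (subst subst_unfold[of "\<psi> \<circledast> \<chi>"]) simp
    finally show ?case .
  qed
qed

lemma word_conv_assoc: "f \<circledast> \<psi> \<circledast> \<chi> = f \<circledast> (\<psi> \<circledast> \<chi>)"
  by (simp add: word_conv_def[of _ \<chi>] word_conv_def[of f] subst_dprod subst_subst dprod_assoc)

text \<open>By the next three lemmas, a product at \<open>w\<close> involves the value at \<open>w\<close> of the series that is
  solved for either through a single explicit term or not at all. So equations between series
  can be solved, and solved uniquely, by recursion on the length of words.\<close>

lemma dprod_shorter_zero:
  assumes "\<And>v. length v < length w \<Longrightarrow> h v = 0"
  shows "(h \<odot> g) w = h w * g []"
proof -
  have "(h \<odot> g) w = (\<Sum>k\<in>{length w}. h (take k w) * g (drop k w))"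
    unfolding dprod_eq_sum using assms by (intro sum.mono_neutral_right) auto
  then show ?thesis by simp
qed

lemma dprod_local:
  assumes "b [] = 0" "\<And>v. length v < length w \<Longrightarrow> f v = g v"
  shows "(b \<odot> f) w = (b \<odot> g) w"
  unfolding dprod_eq_sum
proof (intro sum.cong refl)
  show "b (take k w) * f (drop k w) = b (take k w) * g (drop k w)" for k
    using assms by (cases "k = 0 \<or> w = []") auto
qed

lemma word_conv_shorter_zero:
  assumes "\<And>v. length v < length w \<Longrightarrow> h v = 0" "\<chi> [] = 1"
  shows "(h \<circledast> \<chi>) w = h w"
proof -
  have subst: "subst \<chi> h w = h w" if "\<And>v. length v < length w \<Longrightarrow> h v = 0" for h w
    using that
  proof (induction w arbitrary: h rule: length_induct)
    case (1 w)
    show ?case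
    proof (cases w)
      case Nil
      then show ?thesis by (subst subst_unfold) simp
    next
      case (Cons b v)
      have h: "subst \<chi> (\<lambda>u. h (a # u)) x = h (a # x)" if "length x \<le> length v" for a x
        using 1 that Cons by auto
      have "letter_sum (\<lambda>u. \<chi> (b # u)) (\<lambda>a. subst \<chi> (\<lambda>u. h (a # u))) v =
          letter_sum (\<lambda>u. \<chi> (b # u)) (\<lambda>a v. 0) v"
        using 1(2) Cons h by (intro letter_sum_cong) auto
      then show ?thesis
        using 1(2)[of "[]"] Cons h[of v b] assms(2)
        by (subst subst_unfold) (simp add: letter_sum_linear_right)
    qed
  qed
  have "subst \<chi> h v = 0" if "length v < length w" for v
    using subst[of v h] assms(1) that by auto
  then show ?thesis
    unfolding word_conv_def using dprod_shorter_zero[of w "subst \<chi> h" \<chi>] subst[of w h] assms by simp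
qed

lemma word_fun_eqI:
  assumes "\<And>w. (\<And>v. length v < length w \<Longrightarrow> f v = g v) \<Longrightarrow> f w = g w"
  shows "f = g"
proof
  show "f w = g w" for w by (induction w rule: length_induct) (use assms in blast)
qed

text \<open>Solving an equation \<open>T f = f\<close> word by word gives a function on words but not its
  multilinearity. Iterating \<open>T\<close> from \<open>0\<close> settles both: every iterate is multilinear, and on
  words of length less than \<open>n\<close> all iterates from the \<open>n\<close>-th on agree.\<close>

lemma multilinear_fixed_point:
  fixes T :: "('a::complex_vector list \<Rightarrow> complex) \<Rightarrow> 'a list \<Rightarrow> complex"
  assumes multilin: "\<And>f. multilinear f \<Longrightarrow> multilinear (T f)"
    and local: "\<And>f g w. (\<And>v. length v < length w \<Longrightarrow> f v = g v) \<Longrightarrow> T f w = T g w"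
  obtains f where "multilinear f" "T f = f"
proof -
  define F where "F n = (T ^^ n) (\<lambda>w. 0)" for n
  have multi: "multilinear (F n)" for n
  proof (induction n)
    case 0
    show ?case by (simp add: F_def multilinear_def clinear_zero_fun)
  next
    case (Suc n)
    then show ?case by (simp add: F_def multilin)
  qed
  have stable: "F m w = F n w" if "length w < m" "length w < n" for m n w
    using that
  proof (induction m arbitrary: n w)
    case (Suc m)
    then obtain n' where n: "n = Suc n'" by (cases n) auto
    have "T (F m) w = T (F n') w"
      using Suc n by (intro local Suc.IH) auto
    then show ?case by (simp add: F_def n)
  qed simp
  define f where "f w = F (Suc (length w)) w" for w
  have f: "f w = F n w" if "length w < n" for n w
    unfolding f_def using that by (intro stable) auto
  have "T f w = f w" for w
  proof -
    have "T f w = T (F (length w)) w" by (intro local f)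
    then show ?thesis by (simp add: f_def F_def)
  qed
  moreover have "multilinear f"
    using multi[unfolded multilinear_def] by (simp add: f_def multilinear_def)
  ultimately show ?thesis using that by blast
qed

lemma multilinear_dprod:
  assumes "multilinear f" "multilinear g"
  shows "multilinear (f \<odot> g)"
proof -
  have "clinear (\<lambda>a. (f \<odot> g) (xs @ a # ys))" if "multilinear f" for f xs ys
    using that
  proof (induction xs arbitrary: f)
    case Nil
    have head: "clinear (\<lambda>a. h (a # u))" if "multilinear h" for h :: "'a list \<Rightarrow> complex" and u
      using that[unfolded multilinear_def, rule_format, of "[]" u] by simp
    from head[OF Nil] head[OF assms(2)] show ?case
      unfolding clinear_iff by (simp add: dprod_linear_left scaleC_complex_def algebra_simps)
  next
    case (Cons x xs)
    have "multilinear (\<lambda>u. f (x # u))"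
      using multilinear_append(1)[OF Cons.prems, of "[x]"] by simp
    moreover have "clinear (\<lambda>a. g ((x # xs) @ a # ys))"
      using assms(2) unfolding multilinear_def by blast
    ultimately show ?case
      using Cons.IH[of "\<lambda>u. f (x # u)"]
      unfolding clinear_iff by (simp add: scaleC_complex_def algebra_simps)
  qed
  then show ?thesis using assms by (simp add: multilinear_def)
qed

lemma multilinear_delta: "multilinear (delta :: 'a::complex_vector list \<Rightarrow> complex)"
  by (simp add: multilinear_def delta_def clinear_zero_fun)

lemma multilinear_add: "multilinear f \<Longrightarrow> multilinear g \<Longrightarrow> multilinear (\<lambda>w. f w + g w)"
  by (simp add: multilinear_def clinear_add_fun)

lemma multilinear_diff: "multilinear f \<Longrightarrow> multilinear g \<Longrightarrow> multilinear (\<lambda>w. f w - g w)"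
  by (simp add: multilinear_def clinear_iff cvec.scale_right_diff_distrib)

section \<open>Gaps between chosen positions\<close>

lemma components_initial: "components {0..<k} = (if k = 0 then [] else [{0..<k}])"
proof (cases "k = 0")
  case False
  then have "{0..<k} - Suc ` {0..<k} = {0}"
    by (auto simp: image_Suc_atLeastLessThan)
  moreover have "component_at {0..<k} 0 = {0..<k}"
    using False by (auto simp: component_at_def)
  ultimately show ?thesis using False by (simp add: components_def)
qed (simp add: components_def)

lemma prod_components:
  fixes g :: "nat set \<Rightarrow> complex"
  assumes "finite C"
  shows "prod_list (map g (components C)) = (\<Prod>i\<in>C - Suc ` C. g (component_at C i))"
  using assms prod.distinct_set_conv_list[of "sorted_list_of_set (C - Suc ` C)" "\<lambda>i. g (component_at C i)"]
  by (simp add: components_def comp_def)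

lemma nths_beyond:
  assumes "\<And>i. i \<in> A \<Longrightarrow> length u \<le> i"
  shows "nths u A = []"
proof -
  have "set (nths u A) = {}" unfolding set_nths using assms by force
  then show ?thesis by simp
qed

text \<open>The positions \<open>{0..<k}\<close> of \<open>u\<close> form the first component (none if \<open>u\<close> is empty, which
  \<open>\<chi> [] = 1\<close> accounts for); the letter \<open>a\<close> at position \<open>k\<close> separates them from the shifted
  components of \<open>C\<close>.\<close>

lemma prod_components_insert_gap:
  fixes \<chi> :: "'a list \<Rightarrow> complex"
  assumes "finite C" "\<chi> [] = 1"
  shows "prod_list (map (\<lambda>J. \<chi> (nths (u @ a # w) J))
      (components ({0..<length u} \<union> (+) (Suc (length u)) ` C))) =
    \<chi> u * prod_list (map (\<lambda>J. \<chi> (nths w J)) (components C))"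
proof -
  define k where "k = length u"
  define s where "s = (+) (Suc k)"
  let ?D = "{0..<k} \<union> s ` C"
  have starts: "?D - Suc ` ?D = (if k = 0 then {} else {0}) \<union> s ` (C - Suc ` C)"
  proof -
    have "s ` C - Suc ` ({0..<k} \<union> s ` C) = s ` (C - Suc ` C)"
      unfolding s_def by (auto simp: image_iff)
    moreover have "{0..<k} - Suc ` ({0..<k} \<union> s ` C) = (if k = 0 then {} else {0})"
    proof -
      have "j \<in> Suc ` {0..<k}" if "j < k" "j \<noteq> 0" for j
        using that by (intro image_eqI[of _ _ "j - 1"]) auto
      then show ?thesis by (auto simp: image_Un)
    qed
    ultimately show ?thesis by (simp add: Un_Diff)
  qed
  have k_notin: "k \<notin> ?D" by (auto simp: s_def)
  have first: "component_at ?D 0 = {0..<k}"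
  proof (intro equalityI subsetI)
    fix j assume "j \<in> component_at ?D 0"
    then have "{0..j} \<subseteq> ?D" by (simp add: component_at_def)
    then have "\<not> k \<le> j" using k_notin by auto
    then show "j \<in> {0..<k}" by simp
  qed (auto simp: component_at_def)
  have later: "component_at ?D (s i) = s ` component_at C i" for i
  proof -
    have sub: "{s i..s j} \<subseteq> ?D \<longleftrightarrow> {i..j} \<subseteq> C" for j
    proof -
      have "{s i..s j} = s ` {i..j}"
        unfolding s_def image_add_atLeastAtMost by (simp add: add.commute)
      moreover have "s ` {i..j} \<subseteq> ?D \<longleftrightarrow> {i..j} \<subseteq> C" by (auto simp: s_def)
      ultimately show ?thesis by simp
    qed
    show ?thesis
    proof (intro equalityI subsetI)
      fix j assume j: "j \<in> component_at ?D (s i)"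
      then have "j = s (j - Suc k)" by (auto simp: component_at_def s_def)
      moreover from this have "j - Suc k \<in> component_at C i"
        using j sub[of "j - Suc k"] by (auto simp: component_at_def s_def)
      ultimately show "j \<in> s ` component_at C i" by blast
    next
      fix j assume "j \<in> s ` component_at C i"
      then obtain j' where "j = s j'" "i \<le> j'" "{i..j'} \<subseteq> C" by (auto simp: component_at_def)
      then show "j \<in> component_at ?D (s i)"
        using sub[of j'] by (simp add: component_at_def) (simp add: s_def)
    qed
  qed
  have nths_first: "nths (u @ a # w) {0..<k} = u"
    by (simp add: k_def nths_append nths_all)
  have nths_later: "nths (u @ a # w) (s ` J) = nths w J" for J
  proof -
    have "nths u (s ` J) = []"
      by (rule nths_beyond) (auto simp: s_def k_def)
    moreover have "{j. Suc (j + k) \<in> s ` J} = J" by (auto simp: s_def image_iff)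
    ultimately show ?thesis by (auto simp: nths_middle k_def[symmetric] s_def)
  qed
  have "prod_list (map (\<lambda>J. \<chi> (nths (u @ a # w) J)) (components ?D)) =
      (\<Prod>i\<in>(if k = 0 then {} else {0}) \<union> s ` (C - Suc ` C). \<chi> (nths (u @ a # w) (component_at ?D i)))"
    unfolding starts[symmetric] using assms by (intro prod_components) auto
  also have "\<dots> = (\<Prod>i\<in>(if k = 0 then {} else {0}). \<chi> (nths (u @ a # w) (component_at ?D i))) *
      (\<Prod>i\<in>s ` (C - Suc ` C). \<chi> (nths (u @ a # w) (component_at ?D i)))"
    using assms by (intro prod.union_disjoint) (auto simp: s_def)
  also have "(\<Prod>i\<in>(if k = 0 then {} else {0}). \<chi> (nths (u @ a # w) (component_at ?D i))) = \<chi> u"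
    using assms(2) first nths_first by (auto simp: k_def)
  also have "(\<Prod>i\<in>s ` (C - Suc ` C). \<chi> (nths (u @ a # w) (component_at ?D i))) =
      (\<Prod>i\<in>C - Suc ` C. \<chi> (nths w (component_at C i)))"
    by (subst prod.reindex) (simp_all add: later nths_later, simp add: s_def)
  finally show ?thesis using assms(1) by (simp add: prod_components k_def s_def)
qed

definition gap_prod :: "('a list \<Rightarrow> complex) \<Rightarrow> 'a list \<Rightarrow> nat set \<Rightarrow> complex"
  where "gap_prod \<chi> w S =
    prod_list (map (\<lambda>J. \<chi> (nths w J)) (components ({0..<length w} - S)))"

lemma gap_sum_insert:
  fixes \<chi> :: "'a list \<Rightarrow> complex"
  assumes "\<chi> [] = 1"
  defines "s u \<equiv> (+) (Suc (length u))"
  shows "nths (u @ a # w) (insert (length u) (s u ` S)) = a # nths w S"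
    and "gap_prod \<chi> (u @ a # w) (insert (length u) (s u ` S)) = \<chi> u * gap_prod \<chi> w S"
proof -
  let ?S = "insert (length u) (s u ` S)"
  have "nths u ?S = []" by (rule nths_beyond) (auto simp: s_def)
  moreover have "{j. Suc (j + length u) \<in> ?S} = S" by (auto simp: s_def image_iff)
  ultimately show "nths (u @ a # w) ?S = a # nths w S"
    by (simp add: nths_middle)
  have "{0..<length (u @ a # w)} - ?S = {0..<length u} \<union> s u ` ({0..<length w} - S)"
  proof (intro equalityI subsetI)
    fix j assume j: "j \<in> {0..<length (u @ a # w)} - ?S"
    show "j \<in> {0..<length u} \<union> s u ` ({0..<length w} - S)"
    proof (cases "j < length u")
      case False
      then have "j > length u" using j by auto
      then have "j = s u (j - Suc (length u))" by (simp add: s_def)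
      moreover from this have "j - Suc (length u) \<in> {0..<length w} - S" using j \<open>j > length u\<close> by auto
      ultimately show ?thesis by blast
    qed simp
  qed (auto simp: s_def)
  then show "gap_prod \<chi> (u @ a # w) ?S = \<chi> u * gap_prod \<chi> w S"
    using prod_components_insert_gap[of "{0..<length w} - S" \<chi> u a w] assms(1)
    by (simp add: gap_prod_def s_def)
qed

lemma sum_Pow_insert_gap:
  fixes \<chi> :: "'a list \<Rightarrow> complex"
  assumes "\<chi> [] = 1"
  shows "(\<Sum>S\<in>{S. S \<subseteq> {length u..<length u + Suc (length w)} \<and> length u \<in> S}.
      f (nths (u @ a # w) S) * gap_prod \<chi> (u @ a # w) S) =
    \<chi> u * (\<Sum>S\<in>Pow {0..<length w}. f (a # nths w S) * gap_prod \<chi> w S)"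
proof -
  define s where "s = (+) (Suc (length u))"
  define ins where "ins S = insert (length u) (s ` S)" for S
  have inj: "inj_on ins (Pow {0..<length w})"
  proof (rule inj_onI)
    fix S T assume "ins S = ins T"
    then have "s -` ins S = s -` ins T" by simp
    moreover have "s -` ins S = S" for S by (auto simp: ins_def s_def)
    ultimately show "S = T" by simp
  qed
  have img: "{S. S \<subseteq> {length u..<length u + Suc (length w)} \<and> length u \<in> S} =
      ins ` Pow {0..<length w}"
  proof (intro equalityI subsetI)
    fix S assume S: "S \<in> {S. S \<subseteq> {length u..<length u + Suc (length w)} \<and> length u \<in> S}"
    have "j \<in> ins (s -` S)" if "j \<in> S" for j
    proof (cases "j = length u")
      case False
      then have "j = s (j - Suc (length u))" using S that by (force simp: s_def)
      then show ?thesis using that by (simp add: ins_def image_iff) metis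
    qed (simp add: ins_def)
    then have "S = ins (s -` S)" using S by (auto simp: ins_def)
    moreover have "s -` S \<subseteq> {0..<length w}" using S by (auto simp: s_def)
    ultimately show "S \<in> ins ` Pow {0..<length w}" by blast
  qed (auto simp: ins_def s_def)
  show ?thesis
    unfolding img
    using gap_sum_insert[where \<chi> = \<chi>, OF assms, where u = u and a = a and w = w]
    by (subst sum.reindex[OF inj]) (simp add: ins_def s_def sum_distrib_left mult.left_commute)
qed

text \<open>The sum over all \<open>S\<close> such that the letters of \<open>u\<close> lie in the current, still
  unfinished gap. The next letter either is chosen, which closes the gap with weight
  \<open>\<chi> u\<close>, or is appended to \<open>u\<close>. The second summand has the recursion of \<open>letter_sum\<close>.\<close>

lemma gap_sum_eq:
  fixes \<chi> :: "'a list \<Rightarrow> complex"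
  assumes "\<chi> [] = 1"
  shows "(\<Sum>S\<in>Pow {length u..<length u + length w}. f (nths (u @ w) S) * gap_prod \<chi> (u @ w) S) =
    f [] * \<chi> (u @ w) + letter_sum (\<lambda>v. \<chi> (u @ v)) (\<lambda>a. (\<lambda>v. f (a # v)) \<circledast> \<chi>) w"
proof (induction "length w" arbitrary: u w f)
  case 0
  then show ?case using assms by (simp add: gap_prod_def components_initial nths_all)
next
  case (Suc n)
  then obtain a v where w: "w = a # v" "length v = n" by (cases w) auto
  let ?t = "\<lambda>S. f (nths (u @ a # v) S) * gap_prod \<chi> (u @ a # v) S"
  define I where "I = {length u..<length u + Suc (length v)}"
  define A where "A = {length (u @ [a])..<length (u @ [a]) + length v}"
  have conv: "(\<Sum>S\<in>Pow {0..<length v}. f' (nths v S) * gap_prod \<chi> v S) = (f' \<circledast> \<chi>) v" for f'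
    unfolding word_conv_unfold[of f' \<chi>]
    using Suc.hyps(1)[OF w(2)[symmetric], of f' "[]"] by simp
  have "I = insert (length u) A" "length u \<notin> A" by (auto simp: I_def A_def)
  then have "Pow I = {S. S \<subseteq> I \<and> length u \<in> S} \<union> Pow A"
    "{S. S \<subseteq> I \<and> length u \<in> S} \<inter> Pow A = {}" by blast+
  moreover have "finite I" "finite A" by (simp_all add: I_def A_def)
  ultimately have "(\<Sum>S\<in>Pow I. ?t S) = (\<Sum>S\<in>{S. S \<subseteq> I \<and> length u \<in> S}. ?t S) + (\<Sum>S\<in>Pow A. ?t S)"
    by (metis (no_types, lifting) finite_Pow_iff finite_Un sum.union_disjoint)
  also have "(\<Sum>S\<in>{S. S \<subseteq> I \<and> length u \<in> S}. ?t S) = \<chi> u * ((\<lambda>x. f (a # x)) \<circledast> \<chi>) v"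
    unfolding I_def
    by (rule sum_Pow_insert_gap[where \<chi> = \<chi> and f = f, OF assms, THEN trans]) (simp only: conv[of "\<lambda>x. f (a # x)"])
  also have "(\<Sum>S\<in>Pow A. ?t S) =
      f [] * \<chi> (u @ w) + letter_sum (\<lambda>x. \<chi> (u @ a # x)) (\<lambda>a. (\<lambda>v. f (a # v)) \<circledast> \<chi>) v"
    unfolding A_def
    using Suc.hyps(1)[OF w(2)[symmetric], of f "u @ [a]"] w(1) by simp
  finally show ?case by (simp add: w I_def algebra_simps)
qed

lemma word_conv_eq_sum:
  assumes "\<chi> [] = 1"
  shows "(f \<circledast> \<chi>) w = (\<Sum>S\<in>Pow {0..<length w}. f (nths w S) * gap_prod \<chi> w S)"
  using gap_sum_eq[where \<chi> = \<chi> and u = "[]" and f = f and w = w, OF assms] unfolding word_conv_unfold[of f \<chi>] by simp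

lemma word_conv_Cons_eq_sum:
  assumes "\<chi> [] = 1"
  shows "((\<lambda>u. f (a # u)) \<circledast> \<chi>) w =
    (\<Sum>S\<in>{S. S \<subseteq> {0..<length (a # w)} \<and> 0 \<in> S}. f (nths (a # w) S) * gap_prod \<chi> (a # w) S)"
  using sum_Pow_insert_gap[where \<chi> = \<chi> and u = "[]" and f = f and a = a and w = w, OF assms] assms
  by (simp add: word_conv_eq_sum[where \<chi> = \<chi>, OF assms])

text \<open>Decides which terms survive when an infinitesimal character is evaluated on the
  components: only a single interval starting at the first position.\<close>

lemma initial_or_two_components:
  assumes "C \<subseteq> {0..<n}" "0 \<in> C"
  obtains k where "1 \<le> k" "k \<le> n" "C = {0..<k}" | "length (components C) \<ge> 2"
proof -
  have fin: "finite C" using finite_subset[OF assms(1)] by simp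
  define k where "k = (LEAST k. k \<notin> C)"
  have ex: "n \<notin> C" using assms(1) by auto
  have k: "k \<notin> C" unfolding k_def by (rule LeastI[of "\<lambda>k. k \<notin> C", OF ex])
  have less: "j \<in> C" if "j < k" for j using that not_less_Least unfolding k_def by blast
  have "k \<le> n" unfolding k_def by (rule Least_le[of "\<lambda>k. k \<notin> C", OF ex])
  show ?thesis
  proof (cases "C = {0..<k}")
    case True
    then show ?thesis using that(1)[of k] \<open>k \<le> n\<close> assms(2) by auto
  next
    case False
    then obtain j where "j \<in> C" "k \<le> j" using less by (force simp: not_less)
    obtain i where i: "i \<in> C - Suc ` C" "j \<in> component_at C i"
      using component_at_cover[OF \<open>j \<in> C\<close>] .
    have "k < i"
    proof (rule ccontr)
      assume "\<not> k < i"
      then have "k \<in> {i..j}" using \<open>k \<le> j\<close> by simp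
      then show False using i(2) k by (auto simp: component_at_def)
    qed
    then have "{0, i} \<subseteq> C - Suc ` C" "card {0, i} = 2" using assms(2) i(1) by auto
    then have "2 \<le> card (C - Suc ` C)" using fin by (metis card_mono finite_Diff)
    then show ?thesis using that(2) fin by (simp add: components_def)
  qed
qed

lemma nths_drop: "nths w {k..<length w} = drop k w"
proof (cases "k \<le> length w")
  case True
  have "nths (take k w @ drop k w) {k..<length w} = drop k w"
    unfolding nths_append using True by (subst nths_beyond) (auto intro!: nths_all)
  then show ?thesis by simp
qed simp

lemma nths_take: "k \<le> length w \<Longrightarrow> nths w {0..<k} = take k w"
  by (simp add: atLeast0LessThan nths_upt_eq_take)

lemma bars_components:
  assumes "C \<subseteq> {0..<length w}"
  shows "bars (map (nths w) (components C)) = pure (map word (map (nths w) (components C)))"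
proof -
  have "nths w J \<noteq> []" if J: "J \<in> set (components C)" for J
  proof -
    have "finite C" using assms finite_subset by blast
    then obtain i where "i \<in> C" "J = component_at C i"
      using J by (auto simp: components_def)
    then have "i \<in> J" "i < length w" using assms by (auto simp: component_at_def)
    then have "w ! i \<in> set (nths w J)" by (auto simp: set_nths)
    then show ?thesis by auto
  qed
  then have "filter (\<lambda>w. w \<noteq> []) (map (nths w) (components C)) = map (nths w) (components C)"
    by (simp add: filter_id_conv)
  then show ?thesis by (simp add: bars_def)
qed

section \<open>Linear forms and their values on words\<close>

lemma scaleC_complex: "c *\<^sub>C z = c * (z :: complex)"
  by (simp add: scaleC_complex_def)

lemma cbilinear_form: "clinear f \<Longrightarrow> clinear g \<Longrightarrow> cbilinear (\<lambda>a b. f a * g b :: complex)"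
  by (auto simp: cbilinear_def intro!: clinear_compose[OF _ clinear_times_left]
      clinear_compose[OF _ clinear_times_right])

lemma clinear_tensor_form: "clinear f \<Longrightarrow> clinear g \<Longrightarrow> clinear (tensor_form f g)"
  unfolding tensor_form_def by (intro clinear_tensor_lift cbilinear_form)

lemma clinear_mult_form: "clinear f \<Longrightarrow> clinear (\<lambda>x. f (a * x))"
  for f :: "'b::complex_algebra_1 \<Rightarrow> complex"
  by (rule clinear_compose[OF clinear_times_right])

lemma clinear_times_form: "clinear f \<Longrightarrow> clinear (\<lambda>x. k * f x :: complex)"
  using clinear_scale_fun[of f k] by (simp only: scaleC_complex)

lemma tensor_form_tens_times:
  assumes "clinear f" "clinear g"
  shows "tensor_form f g ((a \<otimes> b) * t) = tensor_form (\<lambda>c. f (a * c)) (\<lambda>d. g (b * d)) t"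
proof -
  note lin = clinear_tensor_form[OF assms]
    clinear_tensor_form[OF clinear_mult_form[OF assms(1), of a] clinear_mult_form[OF assms(2), of b]]
  show ?thesis
    by (induction t rule: tensor_induct)
      (simp_all add: tens_times_tens tensor_form_tens assms clinear_mult_form distrib_left
        mult_scaleC_right clinear_add[OF lin(1)] clinear_add[OF lin(2)]
        clinear_scale[OF lin(1)] clinear_scale[OF lin(2)])
qed

lemma tensor_form_scale:
  assumes "clinear f" "clinear g"
  shows "tensor_form (\<lambda>x. k * f x) g t = k * tensor_form f g t"
    and "tensor_form f (\<lambda>x. k * g x) t = k * tensor_form f g t"
proof -
  note lin = clinear_tensor_form[OF assms] clinear_tensor_form[OF clinear_times_form[OF assms(1), of k] assms(2)]
    clinear_tensor_form[OF assms(1) clinear_times_form[OF assms(2), of k]]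
  show "tensor_form (\<lambda>x. k * f x) g t = k * tensor_form f g t"
    by (induction t rule: tensor_induct)
      (simp_all add: tensor_form_tens assms clinear_times_form distrib_left scaleC_complex
        clinear_add[OF lin(1)] clinear_add[OF lin(2)] clinear_scale[OF lin(1)] clinear_scale[OF lin(2)])
  show "tensor_form f (\<lambda>x. k * g x) t = k * tensor_form f g t"
    by (induction t rule: tensor_induct)
      (simp_all add: tensor_form_tens assms clinear_times_form distrib_left scaleC_complex
        clinear_add[OF lin(1)] clinear_add[OF lin(3)] clinear_scale[OF lin(1)] clinear_scale[OF lin(3)])
qed

lemma clinear_conv: "clinear f \<Longrightarrow> clinear g \<Longrightarrow> clinear (f \<star> g)"
  unfolding conv_def by (rule clinear_compose[OF clinear_Delta clinear_tensor_form])

lemma clinear_half_prec: "clinear f \<Longrightarrow> clinear g \<Longrightarrow> clinear (f \<prec> g)"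
  unfolding half_prec_def by (rule clinear_compose[OF clinear_Delta_prec clinear_tensor_form])

lemma clinear_half_succ: "clinear f \<Longrightarrow> clinear g \<Longrightarrow> clinear (f \<succ> g)"
  unfolding half_succ_def by (rule clinear_compose[OF clinear_Delta_succ clinear_tensor_form])

lemma conv_one: "clinear f \<Longrightarrow> clinear g \<Longrightarrow> (f \<star> g) 1 = f 1 * g 1"
  by (simp add: conv_def Delta_one one_tensor_def tensor_form_tens)

definition on_words :: "'a::complex_vector form \<Rightarrow> 'a list \<Rightarrow> complex"
  where "on_words f w = f (bars [w])"

lemma bars_Nil [simp]: "bars [] = 1" and bars_empty [simp]: "bars [[]] = 1"
  by (simp_all add: bars_def one_talg_def)

lemma bars_Cons: "bars (w # ws) = bars [w] * bars ws"
  using bars_append[of "[w]" ws] by simp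

text \<open>By multilinearity the elements \<open>w\<^sub>1|\<dots>|w\<^sub>m\<close> for words \<open>w\<^sub>i\<close> span the double tensor
  algebra; the factors of a pure tensor are turned into words one after the other.\<close>

lemma dtalg_induct [case_names bars add scale]:
  assumes bars: "\<And>ws. P (bars ws)" and "\<And>x y. P x \<Longrightarrow> P y \<Longrightarrow> P (x + y)" "\<And>c x. P x \<Longrightarrow> P (c *\<^sub>C x)"
  shows "P (x :: 'a::complex_vector dtalg)"
proof (induction x rule: talg_induct)
  case (pure ts)
  have "P (bars us * pure ts)" for us
  proof (induction ts arbitrary: us)
    case Nil
    then show ?case using bars by (simp add: one_talg_def[symmetric])
  next
    case (Cons t ts)
    have lin: "clinear (\<lambda>t. bars us * pure (t # ts))"
      using multilinear_pure[unfolded multilinear_def, rule_format, of "[]" ts]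
      by (auto intro: clinear_compose[OF _ clinear_times_right])
    show ?case
    proof (induction t rule: tplus_induct)
      case (word w)
      have "bars us * pure (word w # ts) = bars (us @ [w]) * pure ts"
        using word by (simp add: bars_append bars_word pure_times_pure mult.assoc)
      then show ?case using Cons.IH by simp
    qed (simp_all only: clinear_add[OF lin] clinear_scale[OF lin] assms(2,3))
  qed
  from this[of "[]"] show ?case by simp
qed (use assms in auto)

lemma form_eqI:
  assumes "clinear f" "clinear g" "\<And>ws. f (bars ws) = g (bars ws)"
  shows "f = (g :: 'a::complex_vector form)"
proof
  show "f x = g x" for x
    by (induction x rule: dtalg_induct)
      (simp_all add: assms clinear_add[OF assms(1)] clinear_add[OF assms(2)]
        clinear_scale[OF assms(1)] clinear_scale[OF assms(2)])
qed

lemma clinear_bars: "clinear (\<lambda>a. bars [xs @ a # ys])"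
proof -
  have "clinear (\<lambda>x :: 'a tplus. pure [x])"
    using multilinear_pure[unfolded multilinear_def, rule_format, of "[]" "[]"] by simp
  then show ?thesis using clinear_compose[OF clinear_word] by (simp add: bars_word)
qed

lemma multilinear_on_words: "clinear f \<Longrightarrow> multilinear (on_words f)"
  unfolding multilinear_def on_words_def using clinear_compose[OF clinear_bars] by blast

lemma characterD:
  assumes "\<Phi> \<in> characters"
  shows "clinear \<Phi>" "\<Phi> 1 = 1" "\<Phi> (x * y) = \<Phi> x * \<Phi> y" "on_words \<Phi> [] = 1"
  using assms by (auto simp: characters_def on_words_def)

lemma character_bars:
  assumes "\<Phi> \<in> characters"
  shows "\<Phi> (bars ws) = prod_list (map (on_words \<Phi>) ws)"
proof (induction ws)
  case Nil
  then show ?case by (simp add: characterD(2)[OF assms])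
next
  case (Cons w ws)
  then show ?case
    unfolding bars_Cons[of w ws] by (simp add: characterD(3)[OF assms] on_words_def)
qed

lemma characterI:
  assumes lin: "clinear \<Phi>" and "\<phi> [] = 1" and words: "\<And>ws. \<Phi> (bars ws) = prod_list (map \<phi> ws)"
  shows "\<Phi> \<in> characters" "on_words \<Phi> = \<phi>"
proof -
  have "\<Phi> (x * y) = \<Phi> x * \<Phi> y" for x y
  proof (induction x rule: dtalg_induct)
    case (bars us)
    show ?case
    proof (induction y rule: dtalg_induct)
      case (bars vs)
      show ?case by (simp add: words flip: bars_append)
    qed (simp_all add: algebra_simps mult_scaleC_right clinear_add[OF lin] clinear_scale[OF lin] scaleC_complex)
  qed (simp_all add: algebra_simps mult_scaleC_left clinear_add[OF lin] clinear_scale[OF lin] scaleC_complex)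
  then show "\<Phi> \<in> characters" using lin words[of "[]"] by (simp add: characters_def)
  show "on_words \<Phi> = \<phi>" using words[of "[w]" for w] by (auto simp: on_words_def)
qed

lemma character_eqI:
  "\<Phi> \<in> characters \<Longrightarrow> \<Psi> \<in> characters \<Longrightarrow> on_words \<Phi> = on_words \<Psi> \<Longrightarrow> \<Phi> = \<Psi>"
  by (rule form_eqI) (simp_all add: characterD character_bars)

definition char_of :: "('a::complex_vector list \<Rightarrow> complex) \<Rightarrow> 'a form"
  where "char_of \<phi> = talg_lift (\<lambda>ts. prod_list (map (tplus_lift \<phi>) ts))"

lemma char_of:
  assumes "multilinear \<phi>" "\<phi> [] = 1"
  shows "char_of \<phi> \<in> characters" "on_words (char_of \<phi>) = \<phi>"
proof -
  have multi: "multilinear (\<lambda>ts. prod_list (map (tplus_lift \<phi>) ts))"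
    by (rule multilinear_prod_list[OF clinear_tplus_lift[OF assms(1)]])
  have "prod_list (map (tplus_lift \<phi>) (map word (filter (\<lambda>w. w \<noteq> []) ws))) = prod_list (map \<phi> ws)" for ws
    by (induction ws) (simp_all add: assms)
  then have "char_of \<phi> (bars ws) = prod_list (map \<phi> ws)" for ws
    unfolding bars_def char_of_def talg_lift_pure[OF multi] .
  moreover have "clinear (char_of \<phi>)"
    unfolding char_of_def by (rule clinear_talg_lift[OF multi])
  ultimately show "char_of \<phi> \<in> characters" "on_words (char_of \<phi>) = \<phi>"
    using characterI[of "char_of \<phi>" \<phi>] assms(2) by auto
qed

lemma counit_character:
  shows "(counit :: 'a::complex_vector form) \<in> characters"
    and "on_words (counit :: 'a form) = delta"
proof -
  have "clinear (counit :: 'a form)"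
    unfolding counit_def by (rule clinear_talg_lift[OF multilinear_counit])
  moreover have "counit (bars ws) = prod_list (map delta ws)" for ws :: "'a list list"
    by (induction ws) (auto simp: bars_def counit_pure delta_def)
  ultimately show "(counit :: 'a form) \<in> characters" "on_words (counit :: 'a form) = delta"
    using characterI[of "counit :: 'a form" delta] by auto
qed

lemma infinitesimalD:
  assumes "\<alpha> \<in> infinitesimal_characters"
  shows "clinear \<alpha>" "\<alpha> 1 = 0" "on_words \<alpha> [] = 0"
    "\<alpha> (x * y) = \<alpha> x * counit y + counit x * \<alpha> y"
proof -
  show lin: "clinear \<alpha>" and one: "\<alpha> 1 = 0" and "on_words \<alpha> [] = 0"
    using assms by (auto simp: infinitesimal_characters_def on_words_def)
  have long: "\<alpha> (pure ts) = 0" if "length ts \<ge> 2" for ts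
    using assms that by (simp add: infinitesimal_characters_def)
  have nil: "\<alpha> (pure []) = 0" using one by (simp add: one_talg_def)
  note clin = characterD(1)[OF counit_character(1)]
  show "\<alpha> (x * y) = \<alpha> x * counit y + counit x * \<alpha> y"
  proof (induction x rule: talg_induct)
    case (pure us)
    show ?case
    proof (induction y rule: talg_induct)
      case (pure vs)
      have "length (us @ vs) \<ge> 2" if "us \<noteq> []" "vs \<noteq> []"
        using that by (cases us; cases vs) auto
      then show ?case using long[of "us @ vs"] nil by (auto simp: pure_times_pure counit_pure)
    qed (simp_all add: algebra_simps mult_scaleC_right clinear_add[OF lin] clinear_scale[OF lin]
        clinear_add[OF clin] clinear_scale[OF clin] scaleC_complex)
  qed (simp_all add: algebra_simps mult_scaleC_left clinear_add[OF lin] clinear_scale[OF lin]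
        clinear_add[OF clin] clinear_scale[OF clin] scaleC_complex)
qed

text \<open>Compatibility with one word to the left suffices, by linearity in the first factor,
  because the counit kills every \<open>w\<^sub>2|\<dots>|w\<^sub>m\<close> with \<open>m \<ge> 2\<close>.\<close>

lemma infinitesimalI:
  assumes lin: "clinear \<alpha>" and one: "\<alpha> 1 = 0"
    and words: "\<And>w x. w \<noteq> [] \<Longrightarrow> \<alpha> (bars [w] * x) = \<alpha> (bars [w]) * counit x"
  shows "\<alpha> \<in> infinitesimal_characters"
proof -
  have single: "clinear (\<lambda>t :: 'a tplus. pure [t])"
    using multilinear_pure[unfolded multilinear_def, rule_format, of "[]" "[]"] by simp
  have "\<alpha> (pure [word w] * x) = \<alpha> (pure [word w]) * counit x" if "w \<noteq> []" for w x
    using words[OF that] that by (simp add: bars_word)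
  then have "\<alpha> (pure [t] * x) = \<alpha> (pure [t]) * counit x" for t x
    by (induction t rule: tplus_induct)
      (simp_all add: clinear_add[OF single] clinear_scale[OF single]
        clinear_add[OF lin] clinear_scale[OF lin] algebra_simps mult_scaleC_left scaleC_complex)
  from this[of t "pure (t' # ts)" for t t' ts] have "\<alpha> (pure (t # t' # ts)) = 0" for t t' ts
    by (simp add: pure_times_pure counit_pure)
  then have "\<alpha> (pure ts) = 0" if "length ts \<ge> 2" for ts
    using that by (cases ts rule: list.exhaust; cases "tl ts") auto
  then show ?thesis using lin one by (simp add: infinitesimal_characters_def)
qed

lemma infinitesimal_bars:
  assumes "\<alpha> \<in> infinitesimal_characters"
  shows "\<alpha> (bars (w # ws)) = on_words \<alpha> w * counit (bars ws) + delta w * \<alpha> (bars ws)"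
  unfolding bars_Cons[of w ws] using infinitesimalD(4)[OF assms, of "bars [w]" "bars ws"]
  by (simp add: on_words_def[symmetric] counit_character(2))

lemma infinitesimal_eqI:
  assumes "\<alpha> \<in> infinitesimal_characters" "\<beta> \<in> infinitesimal_characters" "on_words \<alpha> = on_words \<beta>"
  shows "\<alpha> = \<beta>"
proof (rule form_eqI)
  show "\<alpha> (bars ws) = \<beta> (bars ws)" for ws
    by (induction ws) (simp_all add: infinitesimal_bars infinitesimalD assms)
qed (simp_all add: infinitesimalD assms)

text \<open>The extension of a function on words by zero to \<open>w\<^sub>1|\<dots>|w\<^sub>m\<close> with \<open>m \<ge> 2\<close>.\<close>

definition form_of :: "('a::complex_vector list \<Rightarrow> complex) \<Rightarrow> 'a form"
  where "form_of f = talg_lift (\<lambda>ts. case ts of [] \<Rightarrow> f [] | t # ts' \<Rightarrow> if ts' = [] then tplus_lift f t else 0)"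

lemma form_of:
  assumes "multilinear f"
  shows "clinear (form_of f)" "on_words (form_of f) = f"
    "f [] = 0 \<Longrightarrow> form_of f \<in> infinitesimal_characters"
proof -
  let ?h = "\<lambda>ts. case ts of [] \<Rightarrow> f [] | t # ts' \<Rightarrow> if ts' = [] then tplus_lift f t else 0"
  have multi: "multilinear ?h"
    unfolding multilinear_def
  proof (intro allI)
    show "clinear (\<lambda>a. ?h (xs @ a # ys))" for xs ys
      by (cases xs; cases ys) (simp_all add: clinear_tplus_lift[OF assms] clinear_zero_fun)
  qed
  show "clinear (form_of f)" unfolding form_of_def by (rule clinear_talg_lift[OF multi])
  have pure: "form_of f (pure ts) = ?h ts" for ts
    unfolding form_of_def by (rule talg_lift_pure[OF multi])
  show "on_words (form_of f) = f"
    by (auto simp: on_words_def bars_def pure assms fun_eq_iff)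
  show "form_of f \<in> infinitesimal_characters" if "f [] = 0"
  proof -
    have "form_of f (pure ts) = 0" if "length ts \<ge> 2" for ts
      using that by (cases ts) (auto simp: pure)
    then show ?thesis
      using that \<open>clinear (form_of f)\<close> by (auto simp: infinitesimal_characters_def one_talg_def pure)
  qed
qed

section \<open>The products in terms of words\<close>

lemma Delta_bars_single: "Delta (bars [w]) = Delta_word w"
proof (cases "w = []")
  case True
  then show ?thesis
    using components_initial[of 0] by (simp add: Delta_one Delta_word_def Delta_term_def one_tensor_def)
qed (simp add: bars_word Delta_single)

text \<open>The multiplicative rules defining the half-coproducts, with an arbitrary element of the
  algebra in place of the remaining factors.\<close>

lemma Delta_prec_pure_mult: "Delta_prec (pure [t] * x) = tplus_lift Delta_prec_word t * Delta x"
  and Delta_succ_pure_mult: "Delta_succ (pure [t] * x) = tplus_lift Delta_succ_word t * Delta x"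
proof -
  note lin = clinear_add[OF clinear_Delta_prec] clinear_scale[OF clinear_Delta_prec]
    clinear_add[OF clinear_Delta_succ] clinear_scale[OF clinear_Delta_succ]
    clinear_add[OF clinear_Delta] clinear_scale[OF clinear_Delta]
  show "Delta_prec (pure [t] * x) = tplus_lift Delta_prec_word t * Delta x"
    by (induction x rule: talg_induct)
      (simp_all add: pure_times_pure Delta_prec_pure distrib_left mult_scaleC_right lin)
  show "Delta_succ (pure [t] * x) = tplus_lift Delta_succ_word t * Delta x"
    by (induction x rule: talg_induct)
      (simp_all add: pure_times_pure Delta_succ_pure distrib_left mult_scaleC_right lin)
qed

lemma tensor_form_sum_times:
  assumes "clinear f" "clinear g"
  shows "tensor_form f g (sum h A * t) = (\<Sum>S\<in>A. tensor_form f g (h S * t))"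
  unfolding sum_distrib_right by (rule clinear_sum[OF clinear_tensor_form[OF assms]])

text \<open>A character turns the components into a product of its values on words, and on the
  remaining factor \<open>x\<close> another convolution is left.\<close>

lemma tensor_form_Delta_term_character:
  assumes f: "clinear f" and \<Psi>: "\<Psi> \<in> characters"
  shows "tensor_form f \<Psi> (Delta_term S w * Delta x) =
    gap_prod (on_words \<Psi>) w S * ((\<lambda>c. f (bars [nths w S] * c)) \<star> \<Psi>) x"
  using characterD(1)[OF \<Psi>] f
  by (simp add: Delta_term_def tensor_form_tens_times characterD(3)[OF \<Psi>] tensor_form_scale
      clinear_mult_form conv_def gap_prod_def character_bars[OF \<Psi>] comp_def)

lemma conv_bars_mult:
  assumes f: "clinear f" and \<Psi>: "\<Psi> \<in> characters"
  shows "(f \<star> \<Psi>) (bars [w] * x) = (\<Sum>S\<in>Pow {0..<length w}.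
    gap_prod (on_words \<Psi>) w S * ((\<lambda>c. f (bars [nths w S] * c)) \<star> \<Psi>) x)"
  unfolding tensor_form_Delta_term_character[OF assms, symmetric] 
    tensor_form_sum_times[OF f characterD(1)[OF \<Psi>], symmetric]
  by (simp add: conv_def Delta_mult Delta_bars_single Delta_word_def)

lemma half_prec_bars_mult:
  assumes f: "clinear f" and \<Psi>: "\<Psi> \<in> characters" and w: "w \<noteq> []"
  shows "(f \<prec> \<Psi>) (bars [w] * x) = (\<Sum>S\<in>{S. S \<subseteq> {0..<length w} \<and> 0 \<in> S}.
    gap_prod (on_words \<Psi>) w S * ((\<lambda>c. f (bars [nths w S] * c)) \<star> \<Psi>) x)"
  unfolding tensor_form_Delta_term_character[OF f \<Psi>, symmetric]
    tensor_form_sum_times[OF f characterD(1)[OF \<Psi>], symmetric]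
  by (simp add: half_prec_def bars_word[OF w] Delta_prec_pure_mult Delta_prec_word_def[symmetric]
      multilinear_Delta_word w)

text \<open>For \<open>x = 1\<close> the sum over the chosen positions in \<open>conv_bars_mult\<close> is the one that
  \<open>word_conv_eq_sum\<close> identifies. This turns convolution with a character into an operation on series.\<close>

lemma on_words_conv:
  assumes f: "clinear f" and \<Psi>: "\<Psi> \<in> characters"
  shows "on_words (f \<star> \<Psi>) = on_words f \<circledast> on_words \<Psi>"
proof
  fix w
  have "((\<lambda>c. f (y * c)) \<star> \<Psi>) 1 = f y" for y
    using conv_one[OF clinear_mult_form[OF f] characterD(1)[OF \<Psi>]] by (simp add: characterD(2)[OF \<Psi>])
  then show "on_words (f \<star> \<Psi>) w = (on_words f \<circledast> on_words \<Psi>) w"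
    using conv_bars_mult[OF assms, of w 1]
    by (simp add: on_words_def[of _ w] word_conv_eq_sum characterD(4)[OF \<Psi>] on_words_def[of f] mult.commute)
qed

text \<open>The right counit law for the coproduct. It is needed for all linear forms, not only for
  characters, because it is applied below to forms such as \<open>\<lambda>c. f (y * c)\<close>.\<close>

lemma conv_counit:
  assumes "clinear g"
  shows "g \<star> counit = g"
proof (rule form_eqI)
  note eps = counit_character[where 'a = 'a]
  show "(g \<star> counit) (bars ws) = g (bars ws)" for ws
    using assms
  proof (induction ws arbitrary: g)
    case Nil
    then show ?case by (simp add: conv_one characterD[OF eps(1)])
  next
    case (Cons w ws)
    have "(g \<star> counit) (bars (w # ws)) = (\<Sum>S\<in>Pow {0..<length w}.
        gap_prod delta w S * g (bars [nths w S] * bars ws))"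
      unfolding bars_Cons[of w ws] conv_bars_mult[OF Cons.prems eps(1)]
      by (simp add: eps(2) Cons.IH clinear_mult_form Cons.prems)
    also have "\<dots> = ((\<lambda>u. g (bars [u] * bars ws)) \<circledast> delta) w"
      by (simp add: word_conv_eq_sum mult.commute)
    also have "\<dots> = g (bars (w # ws))"
      unfolding word_conv_delta_right bars_Cons[of w ws] ..
    finally show ?case .
  qed
qed (use assms in \<open>auto intro: clinear_conv characterD counit_character\<close>)

lemma conv_character:
  assumes "\<Phi> \<in> characters" "\<Psi> \<in> characters"
  shows "\<Phi> \<star> \<Psi> \<in> characters"
proof -
  note lin = characterD(1)[OF assms(1)] characterD(1)[OF assms(2)]
  note tlin = clinear_tensor_form[OF lin]
  have "tensor_form \<Phi> \<Psi> (s * t) = tensor_form \<Phi> \<Psi> s * tensor_form \<Phi> \<Psi> t" for s t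
  proof (induction s rule: tensor_induct)
    case (tens a b)
    show ?case
      by (simp add: tensor_form_tens_times lin characterD(3)[OF assms(1)] characterD(3)[OF assms(2)]
          tensor_form_scale clinear_times_form tensor_form_tens)
  qed (simp_all add: algebra_simps mult_scaleC_left clinear_add[OF tlin] clinear_scale[OF tlin] scaleC_complex)
  then show ?thesis
    using clinear_conv[OF lin] conv_one[OF lin] assms
    by (simp add: characters_def conv_def Delta_mult)
qed

lemma conv_assoc:
  assumes "\<Phi> \<in> characters" "\<Psi> \<in> characters" "\<Theta> \<in> characters"
  shows "\<Phi> \<star> \<Psi> \<star> \<Theta> = \<Phi> \<star> (\<Psi> \<star> \<Theta>)"
  by (rule character_eqI)
    (simp_all add: assms conv_character on_words_conv characterD(1) word_conv_assoc)

lemma counit_conv: "\<Phi> \<in> characters \<Longrightarrow> counit \<star> \<Phi> = \<Phi>"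
  by (rule character_eqI)
    (simp_all add: conv_character on_words_conv characterD(1) counit_character)

text \<open>The equation \<open>\<theta> \<circledast> \<psi> = delta\<close> is rewritten as
  \<open>\<theta> = delta + (\<theta> - \<theta> \<circledast> \<psi>)\<close>. The leading terms of \<open>\<theta>\<close> and
  \<open>\<theta> \<circledast> \<psi>\<close> cancel, so the right hand side at \<open>w\<close> only depends on \<open>\<theta>\<close> at shorter words.\<close>

lemma left_inverse_exists:
  assumes \<Psi>: "\<Psi> \<in> characters"
  obtains \<Theta> where "\<Theta> \<in> characters" "\<Theta> \<star> \<Psi> = counit"
proof -
  define \<psi> where "\<psi> = on_words \<Psi>"
  have one: "\<psi> [] = 1" using characterD(4)[OF \<Psi>] by (simp add: \<psi>_def)
  obtain \<theta> where \<theta>: "multilinear \<theta>" "(\<lambda>w. delta w + (\<theta> w - (\<theta> \<circledast> \<psi>) w)) = \<theta>"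
  proof (rule multilinear_fixed_point[of "\<lambda>\<theta> w. delta w + (\<theta> w - (\<theta> \<circledast> \<psi>) w)"])
    fix f :: "'a list \<Rightarrow> complex" assume f: "multilinear f"
    have "multilinear (on_words (form_of f \<star> \<Psi>))"
      by (intro multilinear_on_words clinear_conv form_of f characterD \<Psi>)
    then have "multilinear (f \<circledast> \<psi>)"
      by (simp add: on_words_conv form_of f \<Psi> \<psi>_def)
    then show "multilinear (\<lambda>w. delta w + (f w - (f \<circledast> \<psi>) w))"
      by (intro multilinear_add multilinear_diff multilinear_delta f)
  next
    fix f g :: "'a list \<Rightarrow> complex" and w :: "'a list"
    assume "\<And>v. length v < length w \<Longrightarrow> f v = g v"
    then have "((\<lambda>u. f u - g u) \<circledast> \<psi>) w = f w - g w"
      by (intro word_conv_shorter_zero one) auto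
    then show "delta w + (f w - (f \<circledast> \<psi>) w) = delta w + (g w - (g \<circledast> \<psi>) w)"
      by (simp add: word_conv_diff_left algebra_simps)
  qed
  have inv: "\<theta> \<circledast> \<psi> = delta"
    using \<theta>(2) by (simp add: fun_eq_iff algebra_simps)
  have "(\<theta> \<circledast> \<psi>) [] = \<theta> []"
    unfolding word_conv_unfold[of \<theta>] by (simp add: one)
  then have "\<theta> [] = 1" using inv by simp
  note \<Theta> = char_of[OF \<theta>(1) this]
  have "char_of \<theta> \<star> \<Psi> = counit"
    by (rule character_eqI)
      (simp_all add: conv_character counit_character on_words_conv characterD(1) \<Theta> \<Psi> inv flip: \<psi>_def)
  then show ?thesis using that \<Theta>(1) by blast
qed

text \<open>A left inverse that has itself a left inverse is a two-sided inverse.\<close>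

lemma char_inverse:
  assumes "\<Psi> \<in> characters"
  shows "char_inverse \<Psi> \<in> characters" "char_inverse \<Psi> \<star> \<Psi> = counit"
proof -
  obtain \<Theta> where \<Theta>: "\<Theta> \<in> characters" "\<Theta> \<star> \<Psi> = counit" using left_inverse_exists[OF assms] .
  obtain \<Xi> where \<Xi>: "\<Xi> \<in> characters" "\<Xi> \<star> \<Theta> = counit" using left_inverse_exists[OF \<Theta>(1)] .
  have "\<Xi> = \<Xi> \<star> (\<Theta> \<star> \<Psi>)" using \<Theta> \<Xi> by (simp add: conv_counit characterD(1))
  also have "\<dots> = \<Psi>" using conv_assoc[OF \<Xi>(1) \<Theta>(1) assms] \<Xi>(2) counit_conv[OF assms] by simp
  finally have right: "\<Psi> \<star> \<Theta> = counit" using \<Xi> by simp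
  have "char_inverse \<Psi> = \<Theta>"
    unfolding char_inverse_def
  proof (rule the_equality)
    fix \<Theta>' assume \<Theta>': "\<Theta>' \<in> characters \<and> \<Theta>' \<star> \<Psi> = counit \<and> \<Psi> \<star> \<Theta>' = counit"
    then have "\<Theta>' = \<Theta>' \<star> (\<Psi> \<star> \<Theta>)" by (simp add: right conv_counit characterD(1))
    also have "\<dots> = \<Theta>" using conv_assoc[of \<Theta>' \<Psi> \<Theta>] \<Theta>' \<Theta>(1) assms counit_conv[OF \<Theta>(1)] by simp
    finally show "\<Theta>' = \<Theta>" .
  qed (use \<Theta> right in simp)
  then show "char_inverse \<Psi> \<in> characters" "char_inverse \<Psi> \<star> \<Psi> = counit" using \<Theta> by simp_all
qed

text \<open>In \<open>f \<succ> \<beta>\<close> the first position is not chosen, and \<open>\<beta>\<close> vanishes unless the positions not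
  chosen form a single component. So \<open>\<beta>\<close> receives a nonempty prefix of \<open>w\<close> and \<open>f\<close> the
  remaining suffix, which is the series product with the factors in the opposite order.\<close>

lemma half_succ_bars_mult:
  assumes f: "clinear f" and \<beta>: "\<beta> \<in> infinitesimal_characters" and w: "w \<noteq> []"
  shows "(f \<succ> \<beta>) (bars [w] * x) = (on_words \<beta> \<odot> (\<lambda>v. f (bars [v] * x))) w"
proof -
  let ?n = "length w"
  define B where "B S = bars (map (nths w) (components ({0..<?n} - S)))" for S
  let ?t = "\<lambda>S. \<beta> (B S) * f (bars [nths w S] * x)"
  let ?A = "{S. S \<subseteq> {0..<?n} \<and> 0 \<notin> S}"
  have pure: "B S = pure (map word (map (nths w) (components ({0..<?n} - S))))" for S
    unfolding B_def by (rule bars_components) auto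
  have summand: "tensor_form f \<beta> (Delta_term S w * Delta x) = ?t S" if "S \<in> ?A" for S
  proof -
    have "0 \<in> {0..<?n} - S" using that w by simp
    then have "{0..<?n} - S - Suc ` ({0..<?n} - S) \<noteq> {}" by blast
    then have "components ({0..<?n} - S) \<noteq> []" by (simp add: components_def)
    then have "counit (B S) = 0" by (simp add: pure counit_pure)
    \<comment> \<open>\<open>\<beta>\<close> is a derivation with respect to the counit, and the components lie in its kernel.\<close>
    then have "tensor_form f \<beta> (Delta_term S w * Delta x) =
        \<beta> (B S) * ((\<lambda>c. f (bars [nths w S] * c)) \<star> counit) x"
      using f infinitesimalD(1)[OF \<beta>]
      by (simp add: Delta_term_def B_def[symmetric] tensor_form_tens_times infinitesimalD(4)[OF \<beta>]
          tensor_form_scale clinear_mult_form conv_def characterD(1)[OF counit_character(1)])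
    then show ?thesis by (simp add: conv_counit clinear_mult_form f)
  qed
  have "(f \<succ> \<beta>) (bars [w] * x) = (\<Sum>S\<in>?A. ?t S)"
    by (simp add: half_succ_def bars_word[OF w] Delta_succ_pure_mult multilinear_Delta_word w
        Delta_succ_word_def tensor_form_sum_times f infinitesimalD(1)[OF \<beta>] summand)
  also have "\<dots> = (\<Sum>S\<in>(\<lambda>k. {k..<?n}) ` {1..?n}. ?t S)"
  proof (rule sum.mono_neutral_right)
    show "\<forall>S\<in>?A - (\<lambda>k. {k..<?n}) ` {1..?n}. ?t S = 0"
    proof
      fix S assume S: "S \<in> ?A - (\<lambda>k. {k..<?n}) ` {1..?n}"
      have "2 \<le> length (components ({0..<?n} - S))"
      proof (rule initial_or_two_components[of "{0..<?n} - S" ?n])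
        fix k assume k: "1 \<le> k" "k \<le> ?n" "{0..<?n} - S = {0..<k}"
        have "S = {0..<?n} - ({0..<?n} - S)" using S by auto
        also have "\<dots> = {k..<?n}" unfolding k(3) by auto
        finally show ?thesis using S k(1,2) by auto
      qed (use S w in auto)
      then have "\<beta> (B S) = 0"
        using \<beta> by (simp add: pure infinitesimal_characters_def)
      then show "?t S = 0" by simp
    qed
  qed auto
  also have "\<dots> = (\<Sum>k\<in>{1..?n}. ?t {k..<?n})"
  proof (rule sum.reindex[unfolded comp_def])
    have "k = l" if "{k..<?n} = {l..<?n}" "k \<in> {1..?n}" "l \<in> {1..?n}" for k l
      using that by (metis atLeastAtMost_iff atLeastLessThan_empty_iff2 atLeastLessThan_inj(1)
          le_neq_implies_less not_less_iff_gr_or_eq)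
    then show "inj_on (\<lambda>k. {k..<?n}) {1..?n}" by (auto simp: inj_on_def)
  qed
  also have "\<dots> = (\<Sum>k\<in>{1..?n}. on_words \<beta> (take k w) * f (bars [drop k w] * x))"
  proof (rule sum.cong[OF refl])
    fix k assume k: "k \<in> {1..?n}"
    then have "{0..<?n} - {k..<?n} = {0..<k}" by auto
    then have "B {k..<?n} = bars [take k w]"
      using k by (simp add: B_def components_initial nths_take)
    then show "?t {k..<?n} = on_words \<beta> (take k w) * f (bars [drop k w] * x)"
      by (simp add: on_words_def nths_drop)
  qed
  \<comment> \<open>The term for \<open>k = 0\<close> vanishes because \<open>\<beta>\<close> does on the empty word.\<close>
  also have "\<dots> = (\<Sum>k\<le>?n. on_words \<beta> (take k w) * f (bars [drop k w] * x))"
    using infinitesimalD(3)[OF \<beta>]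
    by (intro sum.mono_neutral_left) (auto simp: Suc_le_eq)
  finally show ?thesis by (simp add: dprod_eq_sum)
qed

section \<open>The half-shuffle exponential\<close>

lemma half_prec_one: "clinear f \<Longrightarrow> clinear g \<Longrightarrow> (f \<prec> g) 1 = 0"
  and half_succ_one: "clinear f \<Longrightarrow> clinear g \<Longrightarrow> (f \<succ> g) 1 = 0"
  by (simp_all add: half_prec_def half_succ_def Delta_prec_one Delta_succ_one clinear_tensor_form clinear_zero)

lemma clinear_succ_power: "\<beta> \<in> infinitesimal_characters \<Longrightarrow> clinear (succ_power \<beta> n)"
  by (induction n) (simp_all add: clinear_half_succ infinitesimalD(1) characterD(1)[OF counit_character(1)])

text \<open>The half-shuffle exponential solves \<open>\<Phi> = counit + \<Phi> \<succ> \<beta>\<close>, which on words is the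
  equation \<open>\<phi> = delta + \<beta> \<odot> \<phi>\<close>. Its series is summed on \<open>w\<^sub>1|\<dots>|w\<^sub>m\<close> by induction on the
  total length: the last factor of a half-shuffle power removes a nonempty prefix of \<open>w\<^sub>1\<close>.
  Empty words among the \<open>w\<^sub>i\<close> are kept, since a suffix of \<open>w\<^sub>1\<close> may be empty, which is why
  the measure also counts the words.\<close>

lemma succ_power_sums:
  assumes \<beta>: "\<beta> \<in> infinitesimal_characters"
    and fix_eq: "\<phi> = (\<lambda>w. delta w + (on_words \<beta> \<odot> \<phi>) w)"
  shows "(\<lambda>n. succ_power \<beta> n (bars ws)) sums prod_list (map \<phi> ws)"
proof (induction "length ws + sum_list (map length ws)" arbitrary: ws rule: less_induct)
  case less
  have zero: "on_words \<beta> [] = 0" by (rule infinitesimalD(3)[OF \<beta>])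
  have one: "\<phi> [] = 1" using fun_cong[OF fix_eq, of "[]"] zero by simp
  note lin = clinear_succ_power[OF \<beta>] infinitesimalD(1)[OF \<beta>]
  show ?case
  proof (cases ws)
    case Nil
    have "succ_power \<beta> n 1 = (if n = 0 then 1 else 0)" for n
      by (cases n) (simp_all add: characterD(2)[OF counit_character(1)] half_succ_one lin)
    then show ?thesis using Nil sums_single[of 0 "\<lambda>_. 1 :: complex"] by simp
  next
    case (Cons w vs)
    show ?thesis
    proof (cases "w = []")
      case True
      then have "bars ws = bars vs" by (simp add: Cons bars_def)
      then show ?thesis using less[of vs] Cons True one by simp
    next
      case False
      define b where "b = on_words \<beta>"
      have step: "succ_power \<beta> (Suc n) (bars ws) =
          (\<Sum>k\<le>length w. b (take k w) * succ_power \<beta> n (bars (drop k w # vs)))" for n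
        by (simp add: Cons bars_Cons[of _ vs] half_succ_bars_mult lin \<beta> False dprod_eq_sum b_def)
      have "(\<lambda>n. b (take k w) * succ_power \<beta> n (bars (drop k w # vs)))
          sums (b (take k w) * (\<phi> (drop k w) * prod_list (map \<phi> vs)))" if "k \<le> length w" for k
      proof (cases "k = 0")
        case True
        then show ?thesis using zero by (simp add: b_def)
      next
        case False
        then have "(\<lambda>n. succ_power \<beta> n (bars (drop k w # vs))) sums prod_list (map \<phi> (drop k w # vs))"
          using that Cons by (intro less) auto
        then show ?thesis by (intro sums_mult) simp
      qed
      then have "(\<lambda>n. succ_power \<beta> (Suc n) (bars ws)) sums
          (\<Sum>k\<le>length w. b (take k w) * (\<phi> (drop k w) * prod_list (map \<phi> vs)))"
        unfolding step by (intro sums_sum) simp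
      also have "(\<Sum>k\<le>length w. b (take k w) * (\<phi> (drop k w) * prod_list (map \<phi> vs))) =
          (b \<odot> \<phi>) w * prod_list (map \<phi> vs)"
        by (simp add: dprod_eq_sum sum_distrib_right mult.assoc)
      also have "(b \<odot> \<phi>) w = \<phi> w"
        using fun_cong[OF fix_eq, of w] False by (simp add: delta_def b_def)
      finally have "(\<lambda>n. succ_power \<beta> n (bars ws)) sums
          (\<phi> w * prod_list (map \<phi> vs) + succ_power \<beta> 0 (bars ws))"
        by (subst (asm) sums_Suc_iff) simp
      moreover have "succ_power \<beta> 0 (bars ws) = 0"
        using False by (simp add: Cons character_bars counit_character delta_def)
      ultimately show ?thesis by (simp add: Cons)
    qed
  qed
qed

lemma E_succ:
  assumes \<beta>: "\<beta> \<in> infinitesimal_characters"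
  shows "E_succ \<beta> \<in> characters"
    and "on_words (E_succ \<beta>) = (\<lambda>w. delta w + (on_words \<beta> \<odot> on_words (E_succ \<beta>)) w)"
proof -
  have zero: "on_words \<beta> [] = 0" by (rule infinitesimalD(3)[OF \<beta>])
  obtain \<phi> where \<phi>: "multilinear \<phi>" "(\<lambda>w. delta w + (on_words \<beta> \<odot> \<phi>) w) = \<phi>"
  proof (rule multilinear_fixed_point[of "\<lambda>\<phi> w. delta w + (on_words \<beta> \<odot> \<phi>) w"])
    show "multilinear (\<lambda>w. delta w + (on_words \<beta> \<odot> f) w)" if "multilinear f" for f
      using that by (intro multilinear_add multilinear_delta multilinear_dprod multilinear_on_words
          infinitesimalD(1) \<beta>)
  next
    fix f g :: "'a list \<Rightarrow> complex" and w :: "'a list"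
    assume "\<And>v. length v < length w \<Longrightarrow> f v = g v"
    then show "delta w + (on_words \<beta> \<odot> f) w = delta w + (on_words \<beta> \<odot> g) w"
      using dprod_local[of "on_words \<beta>" w f g] zero by simp
  qed
  have one: "\<phi> [] = 1" using fun_cong[OF \<phi>(2), of "[]"] zero by simp
  note \<Phi> = char_of[OF \<phi>(1) one]
  note lin = clinear_succ_power[OF \<beta>] characterD(1)[OF \<Phi>(1)]
  have "(\<lambda>n. succ_power \<beta> n x) sums char_of \<phi> x" for x
  proof (induction x rule: dtalg_induct)
    case (bars ws)
    show ?case
      using succ_power_sums[OF \<beta> \<phi>(2)[symmetric]] by (simp add: character_bars[OF \<Phi>(1)] \<Phi>(2))
  next
    case (add x y)
    then show ?case
      using sums_add by (simp add: clinear_add[OF lin(1)] clinear_add[OF lin(2)])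
  next
    case (scale c x)
    then show ?case
      using sums_mult by (simp add: clinear_scale[OF lin(1)] clinear_scale[OF lin(2)] scaleC_complex)
  qed
  then have "E_succ \<beta> = char_of \<phi>"
    by (auto simp: E_succ_def fun_eq_iff dest: sums_unique[symmetric])
  then show "E_succ \<beta> \<in> characters"
    "on_words (E_succ \<beta>) = (\<lambda>w. delta w + (on_words \<beta> \<odot> on_words (E_succ \<beta>)) w)"
    using \<Phi> \<phi>(2) by simp_all
qed

text \<open>Since \<open>\<phi> [] = 1\<close>, the factor \<open>\<phi>\<close> can be cancelled from \<open>\<beta> \<odot> \<phi> = \<phi> - delta\<close>.\<close>

lemma inj_on_E_succ: "inj_on E_succ (infinitesimal_characters :: 'a::complex_vector form set)"
proof (rule inj_onI)
  fix \<beta> \<gamma> :: "'a form"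
  assume \<beta>: "\<beta> \<in> infinitesimal_characters" and \<gamma>: "\<gamma> \<in> infinitesimal_characters"
    and eq: "E_succ \<beta> = E_succ \<gamma>"
  define \<phi> where "\<phi> = on_words (E_succ \<beta>)"
  have prod: "(on_words \<beta> \<odot> \<phi>) w = (on_words \<gamma> \<odot> \<phi>) w" for w
    using fun_cong[OF E_succ(2)[OF \<beta>], of w] fun_cong[OF E_succ(2)[OF \<gamma>], of w]
    by (simp add: \<phi>_def eq)
  have one: "\<phi> [] = 1" using characterD(4)[OF E_succ(1)[OF \<beta>]] by (simp add: \<phi>_def)
  have "on_words \<beta> = on_words \<gamma>"
  proof (rule word_fun_eqI)
    fix w :: "'a list" assume "\<And>v. length v < length w \<Longrightarrow> on_words \<beta> v = on_words \<gamma> v"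
    then have "((\<lambda>u. on_words \<beta> u - on_words \<gamma> u) \<odot> \<phi>) w = (on_words \<beta> w - on_words \<gamma> w) * \<phi> []"
      by (intro dprod_shorter_zero) simp
    then show "on_words \<beta> w = on_words \<gamma> w"
      by (simp add: dprod_diff_left prod one)
  qed
  then show "\<beta> = \<gamma>" by (rule infinitesimal_eqI[OF \<beta> \<gamma>])
qed

text \<open>Here \<open>\<phi> = delta + b \<odot> \<phi>\<close> is solved for \<open>b\<close>, in the form
  \<open>b = (\<phi> - delta) + (b - b \<odot> \<phi>)\<close> to which the fixed point lemma applies. The exponential of
  the solution is the given character because \<open>\<phi> = delta + b \<odot> \<phi>\<close> determines \<open>\<phi>\<close>.\<close>

lemma E_succ_surj:
  assumes \<Phi>: "\<Phi> \<in> characters"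
  obtains \<beta> where "\<beta> \<in> infinitesimal_characters" "E_succ \<beta> = \<Phi>"
proof -
  define \<phi> where "\<phi> = on_words \<Phi>"
  have one: "\<phi> [] = 1" using characterD(4)[OF \<Phi>] by (simp add: \<phi>_def)
  obtain b where b: "multilinear b" "(\<lambda>w. (\<phi> w - delta w) + (b w - (b \<odot> \<phi>) w)) = b"
  proof (rule multilinear_fixed_point[of "\<lambda>b w. (\<phi> w - delta w) + (b w - (b \<odot> \<phi>) w)"])
    show "multilinear (\<lambda>w. (\<phi> w - delta w) + (f w - (f \<odot> \<phi>) w))" if "multilinear f" for f
      unfolding \<phi>_def using that
      by (intro multilinear_add multilinear_diff multilinear_delta multilinear_dprod
          multilinear_on_words characterD(1) \<Phi>)
  next
    fix f g :: "'a list \<Rightarrow> complex" and w :: "'a list"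
    assume "\<And>v. length v < length w \<Longrightarrow> f v = g v"
    then have "((\<lambda>u. f u - g u) \<odot> \<phi>) w = f w - g w"
      using dprod_shorter_zero[of w "\<lambda>u. f u - g u" \<phi>] one by simp
    then show "(\<phi> w - delta w) + (f w - (f \<odot> \<phi>) w) = (\<phi> w - delta w) + (g w - (g \<odot> \<phi>) w)"
      by (simp add: dprod_diff_left algebra_simps)
  qed
  have \<phi>_eq: "\<phi> w = delta w + (b \<odot> \<phi>) w" for w
    using fun_cong[OF b(2), of w] by (simp add: algebra_simps)
  have "b [] = 0" using \<phi>_eq[of "[]"] one by simp
  note \<beta> = form_of(3)[OF b(1) this]
  have "on_words (E_succ (form_of b)) = \<phi>"
  proof (rule word_fun_eqI)
    fix w :: "'a list" assume "\<And>v. length v < length w \<Longrightarrow> on_words (E_succ (form_of b)) v = \<phi> v"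
    then have "(b \<odot> on_words (E_succ (form_of b))) w = (b \<odot> \<phi>) w"
      by (intro dprod_local \<open>b [] = 0\<close>)
    then show "on_words (E_succ (form_of b)) w = \<phi> w"
      using fun_cong[OF E_succ(2)[OF \<beta>], of w] \<phi>_eq[of w] by (simp add: form_of(2)[OF b(1)])
  qed
  then have "E_succ (form_of b) = \<Phi>"
    by (intro character_eqI E_succ(1) \<beta> \<Phi>) (simp add: \<phi>_def)
  then show ?thesis using that \<beta> by blast
qed

lemma L_succ_E_succ: "\<beta> \<in> infinitesimal_characters \<Longrightarrow> L_succ (E_succ \<beta>) = \<beta>"
  unfolding L_succ_def by (rule the_inv_into_f_f[OF inj_on_E_succ])

lemma L_succ_infinitesimal: "\<Phi> \<in> characters \<Longrightarrow> L_succ \<Phi> \<in> infinitesimal_characters"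
  using E_succ_surj L_succ_E_succ by metis

section \<open>Conjugation of infinitesimal characters by characters\<close>

definition conjugate :: "'a::complex_vector form \<Rightarrow> 'a form \<Rightarrow> 'a form"
  where "conjugate \<beta> \<Psi> = char_inverse \<Psi> \<succ> \<beta> \<prec> \<Psi>"

text \<open>Put \<open>f = \<Theta> \<succ> \<beta>\<close> with \<open>\<Theta>\<close> the inverse of \<open>\<Psi>\<close>. Both claims rest on \<open>\<Theta> \<star> \<Psi> = counit\<close>.
  As \<open>f (w|x) = f w * \<Theta> x\<close>, the half-shuffle \<open>f \<prec> \<Psi>\<close> takes the value
  \<open>(f \<prec> \<Psi>) w * (\<Theta> \<star> \<Psi>) x\<close> at \<open>w|x\<close>, hence is infinitesimal.
  On words, with the first letter \<open>a\<close> split off, \<open>f\<close> is the product of \<open>\<beta>\<^sub>a\<close> and \<open>\<Theta>\<close>, so the conjugate is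
  \<open>subst \<Psi> (\<beta>\<^sub>a \<cdot> \<Theta>) \<cdot> \<Psi> = subst \<Psi> \<beta>\<^sub>a \<cdot> (\<Theta> * \<Psi>) = subst \<Psi> \<beta>\<^sub>a\<close>. Thus the conjugate
  sums over all choices of positions that contain the first and the last one, and the
  inverse has disappeared.\<close>

lemma
  assumes \<beta>: "\<beta> \<in> infinitesimal_characters" and \<Psi>: "\<Psi> \<in> characters"
  shows conjugate_infinitesimal: "conjugate \<beta> \<Psi> \<in> infinitesimal_characters"
    and on_words_conjugate: "on_words (conjugate \<beta> \<Psi>) (a # v) = subst (on_words \<Psi>) (\<lambda>u. on_words \<beta> (a # u)) v"
proof -
  define \<Theta> where "\<Theta> = char_inverse \<Psi>"
  note \<Theta> = char_inverse[OF \<Psi>, folded \<Theta>_def]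
  define f where "f = \<Theta> \<succ> \<beta>"
  have f: "clinear f" unfolding f_def by (intro clinear_half_succ characterD(1) infinitesimalD(1) \<Theta> \<beta>)
  have f_mult: "f (bars [u] * y) = (on_words \<beta> \<odot> on_words \<Theta>) u * \<Theta> y" if "u \<noteq> []" for u y
    using half_succ_bars_mult[OF characterD(1)[OF \<Theta>(1)] \<beta> that, of y]
    by (simp add: f_def characterD(3)[OF \<Theta>(1)] dprod_scale_right flip: on_words_def)
  have f_word: "f (bars [u] * y) = on_words f u * \<Theta> y" if "u \<noteq> []" for u y
    using f_mult[OF that, of y] f_mult[OF that, of 1]
    by (simp add: on_words_def[of f] characterD(2)[OF \<Theta>(1)])
  have mult: "conjugate \<beta> \<Psi> (bars [w] * x) =
      (\<Sum>S\<in>{S. S \<subseteq> {0..<length w} \<and> 0 \<in> S}. on_words f (nths w S) * gap_prod (on_words \<Psi>) w S) * counit x"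
    if w: "w \<noteq> []" for w x
  proof -
    have "((\<lambda>c. f (bars [nths w S] * c)) \<star> \<Psi>) x = on_words f (nths w S) * counit x" if "0 \<in> S" for S
    proof -
      have "nths w S \<noteq> []" using w that by (cases w) (simp_all add: nths_Cons)
      then have "((\<lambda>c. f (bars [nths w S] * c)) \<star> \<Psi>) x =
          on_words f (nths w S) * (\<Theta> \<star> \<Psi>) x"
        by (simp add: f_word conv_def tensor_form_scale characterD(1) \<Theta> \<Psi>)
      then show ?thesis by (simp add: \<Theta>(2))
    qed
    then show ?thesis
      by (simp add: conjugate_def half_prec_bars_mult[OF f \<Psi> w] sum_distrib_left mult_ac
          flip: \<Theta>_def f_def)
  qed
  show "conjugate \<beta> \<Psi> \<in> infinitesimal_characters"
  proof (rule infinitesimalI)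
    show "clinear (conjugate \<beta> \<Psi>)" "conjugate \<beta> \<Psi> 1 = 0"
      using f characterD(1)[OF \<Psi>]
      by (simp_all add: conjugate_def clinear_half_prec half_prec_one flip: \<Theta>_def f_def)
    show "conjugate \<beta> \<Psi> (bars [w] * x) = conjugate \<beta> \<Psi> (bars [w]) * counit x" if "w \<noteq> []" for w x
      using mult[OF that, of x] mult[OF that, of 1] by (simp add: characterD(2)[OF counit_character(1)])
  qed
  have inv: "on_words \<Theta> \<circledast> on_words \<Psi> = delta"
    by (simp add: \<Theta> \<Psi> characterD(1) counit_character flip: on_words_conv)
  have f_Cons: "(\<lambda>u. on_words f (a # u)) = (\<lambda>u. on_words \<beta> (a # u)) \<odot> on_words \<Theta>"
  proof
    fix u
    show "on_words f (a # u) = ((\<lambda>u. on_words \<beta> (a # u)) \<odot> on_words \<Theta>) u"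
      using f_mult[of "a # u" 1] infinitesimalD(3)[OF \<beta>]
      by (simp add: on_words_def[of f] characterD(2)[OF \<Theta>(1)])
  qed
  have "on_words (conjugate \<beta> \<Psi>) (a # v) = ((\<lambda>u. on_words f (a # u)) \<circledast> on_words \<Psi>) v"
    using mult[of "a # v" 1] characterD(4)[OF \<Psi>]
    by (simp add: on_words_def[of "conjugate \<beta> \<Psi>"] word_conv_Cons_eq_sum
        characterD(2)[OF counit_character(1)])
  also have "\<dots> = (subst (on_words \<Psi>) (\<lambda>u. on_words \<beta> (a # u)) \<odot> (on_words \<Theta> \<circledast> on_words \<Psi>)) v"
    by (simp add: f_Cons word_conv_def subst_dprod dprod_assoc)
  also have "\<dots> = subst (on_words \<Psi>) (\<lambda>u. on_words \<beta> (a # u)) v"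
    by (simp add: inv)
  finally show "on_words (conjugate \<beta> \<Psi>) (a # v) = subst (on_words \<Psi>) (\<lambda>u. on_words \<beta> (a # u)) v" .
qed

lemma infinitesimal_add:
  assumes "\<alpha> \<in> infinitesimal_characters" "\<beta> \<in> infinitesimal_characters"
  shows "(\<lambda>x. \<alpha> x + \<beta> x) \<in> infinitesimal_characters"
  using assms by (simp add: infinitesimal_characters_def clinear_add_fun)

lemma on_words_eqI_Cons:
  assumes "\<alpha> \<in> infinitesimal_characters" "\<beta> \<in> infinitesimal_characters"
    and "\<And>a v. on_words \<alpha> (a # v) = on_words \<beta> (a # v)"
  shows "\<alpha> = \<beta>"
proof (rule infinitesimal_eqI[OF assms(1,2)])
  show "on_words \<alpha> = on_words \<beta>"
  proof
    show "on_words \<alpha> w = on_words \<beta> w" for w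
      by (cases w) (simp_all add: assms infinitesimalD(3))
  qed
qed

lemma conjugate_add:
  assumes "\<alpha> \<in> infinitesimal_characters" "\<beta> \<in> infinitesimal_characters" "\<Psi> \<in> characters"
  shows "conjugate (\<lambda>x. \<alpha> x + \<beta> x) \<Psi> = (\<lambda>x. conjugate \<alpha> \<Psi> x + conjugate \<beta> \<Psi> x)"
proof (rule on_words_eqI_Cons)
  have "on_words (\<lambda>x. f x + g x) w = on_words f w + on_words g w" for f g :: "'a form" and w
    by (simp add: on_words_def)
  then show "on_words (conjugate (\<lambda>x. \<alpha> x + \<beta> x) \<Psi>) (a # v) =
      on_words (\<lambda>x. conjugate \<alpha> \<Psi> x + conjugate \<beta> \<Psi> x) (a # v)" for a v
    by (simp add: conjugate_infinitesimal on_words_conjugate infinitesimal_add assms subst_linear)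
qed (intro conjugate_infinitesimal infinitesimal_add assms)+

text \<open>By the formula on words this is the composition law of substitutions.\<close>

lemma conjugate_conjugate:
  assumes "\<beta> \<in> infinitesimal_characters" "\<Psi> \<in> characters" "\<Psi>' \<in> characters"
  shows "conjugate (conjugate \<beta> \<Psi>) \<Psi>' = conjugate \<beta> (\<Psi> \<star> \<Psi>')"
proof (rule on_words_eqI_Cons)
  show "on_words (conjugate (conjugate \<beta> \<Psi>) \<Psi>') (a # v) = on_words (conjugate \<beta> (\<Psi> \<star> \<Psi>')) (a # v)"
    for a v
    by (simp add: conjugate_infinitesimal on_words_conjugate conv_character assms on_words_conv characterD(1) subst_subst)
qed (intro conjugate_infinitesimal conv_character assms)+

section \<open>Associativity of the conditionally monotone convolution\<close>

theorem proposition5p3: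
  shows "(\<forall>p \<in> characters \<times> characters. \<forall>q \<in> characters \<times> characters.
      cmon_conv p q \<in> (characters \<times> characters :: ('a::complex_algebra_1 form \<times> 'a form) set)) \<and>
    (\<forall>p \<in> characters \<times> characters. \<forall>q \<in> characters \<times> characters. \<forall>r \<in> characters \<times> characters.
      cmon_conv (cmon_conv p q) r = cmon_conv p (cmon_conv q r :: 'a form \<times> 'a form))"
proof -
  have eq: "cmon_conv (\<Phi>, \<Psi>) (\<Phi>', \<Psi>') =
      (E_succ (\<lambda>x. L_succ \<Phi>' x + conjugate (L_succ \<Phi>) \<Psi>' x), \<Psi> \<star> \<Psi>')"
    for \<Phi> \<Psi> \<Phi>' \<Psi>' :: "'a form"
    by (simp add: cmon_conv_def Let_def conjugate_def)
  note inf = infinitesimal_add conjugate_infinitesimal L_succ_infinitesimal conv_character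
  show ?thesis
  proof (intro conjI ballI)
    fix p q :: "'a form \<times> 'a form"
    assume "p \<in> characters \<times> characters" "q \<in> characters \<times> characters"
    then show "cmon_conv p q \<in> characters \<times> characters"
      by (cases p; cases q) (simp add: eq inf E_succ(1))
  next
    fix p q r :: "'a form \<times> 'a form"
    assume "p \<in> characters \<times> characters" "q \<in> characters \<times> characters" "r \<in> characters \<times> characters"
    then show "cmon_conv (cmon_conv p q) r = cmon_conv p (cmon_conv q r)"
      \<comment> \<open>Both first components are \<open>E_succ\<close> of \<open>\<beta>\<^sub>3 + conjugate \<beta>\<^sub>2 \<Psi>\<^sub>3 + conjugate \<beta>\<^sub>1 (\<Psi>\<^sub>2 \<star> \<Psi>\<^sub>3)\<close>.\<close>
      by (cases p; cases q; cases r)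
        (simp add: eq inf L_succ_E_succ conjugate_add conjugate_conjugate conv_assoc add.assoc)
  qed
qed

end
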